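(* The following is provable in ZF (without the Axiom of Choice): $\mathcal{P}_{G,H_2}$ is equivalent to $AC_2$.
   Context: A homomorphism from a graph $G=(V_G,E_G)$ to a graph $H=(V_H,E_H)$ is a map $f:V_G\to V_H$ such that $\{v_1,v_2\}\in E_G$ implies $\{f(v_1),f(v_2)\}\in E_H$. The graph $H$ is allowed to have loops, i.e. edges of the form $\{v,v\}$. $\mathcal{P}_{G,H_2}$: for any infinite graph $G=(V_G,E_G)$ and any finite graph $H=(V_H,E_H)$ on $2$ vertices, if every finite subgraph of $G$ has a homomorphism into $H$, then so has $G$. $AC_2$: every family of pairs ($2$-element sets) has a choice function. *)

theory Defs
  imports Main
begin

section \<open>First-order logic over the language of set theory\<close>

text \<open>
  Isabelle/HOL itself has a global choice operator, so a statement about provability in ZF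
  cannot be expressed by quantifying over HOL sets.  Instead, ZF is formalized as a first-order
  theory: formulas are syntactic objects, and derivability an inductively defined relation.
  Variables are de Bruijn indices; the only terms are variables.
\<close>

datatype fm = Mem nat nat | Eq nat nat | Fls | Imp fm fm | All fm

primrec ren :: "(nat \<Rightarrow> nat) \<Rightarrow> fm \<Rightarrow> fm" where
  "ren r (Mem i j) = Mem (r i) (r j)"
| "ren r (Eq i j) = Eq (r i) (r j)"
| "ren r Fls = Fls"
| "ren r (Imp p q) = Imp (ren r p) (ren r q)"
| "ren r (All p) = All (ren (case_nat 0 (\<lambda>i. Suc (r i))) p)"

text \<open>Substitution of the variable \<open>t\<close> for index 0, with the remaining indices moving down by one.\<close>

definition subst0 :: "nat \<Rightarrow> fm \<Rightarrow> fm" where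
  "subst0 t p = ren (case_nat t (\<lambda>i. i)) p"

text \<open>
  Natural deduction for classical first-order logic with equality.  In \<open>AllI\<close>, shifting the
  context makes index 0 fresh for it (the eigenvariable condition).
\<close>

inductive derivable :: "fm set \<Rightarrow> fm \<Rightarrow> bool" (infix "\<turnstile>" 50) where
  Assm: "p \<in> \<Gamma> \<Longrightarrow> \<Gamma> \<turnstile> p"
| ImpI: "insert p \<Gamma> \<turnstile> q \<Longrightarrow> \<Gamma> \<turnstile> Imp p q"
| ImpE: "\<Gamma> \<turnstile> Imp p q \<Longrightarrow> \<Gamma> \<turnstile> p \<Longrightarrow> \<Gamma> \<turnstile> q"
| Classical: "insert (Imp p Fls) \<Gamma> \<turnstile> Fls \<Longrightarrow> \<Gamma> \<turnstile> p"
| AllI: "ren Suc ` \<Gamma> \<turnstile> p \<Longrightarrow> \<Gamma> \<turnstile> All p"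
| AllE: "\<Gamma> \<turnstile> All p \<Longrightarrow> \<Gamma> \<turnstile> subst0 t p"
| EqRefl: "\<Gamma> \<turnstile> Eq t t"
| EqSubst: "\<Gamma> \<turnstile> Eq s t \<Longrightarrow> \<Gamma> \<turnstile> subst0 s p \<Longrightarrow> \<Gamma> \<turnstile> subst0 t p"

text \<open>All free variables of \<open>p\<close> have index below \<open>fv_bound p\<close>.\<close>

primrec fv_bound :: "fm \<Rightarrow> nat" where
  "fv_bound (Mem i j) = max (Suc i) (Suc j)"
| "fv_bound (Eq i j) = max (Suc i) (Suc j)"
| "fv_bound Fls = 0"
| "fv_bound (Imp p q) = max (fv_bound p) (fv_bound q)"
| "fv_bound (All p) = fv_bound p - 1"

definition univ_closure :: "fm \<Rightarrow> fm" where
  "univ_closure p = (All ^^ fv_bound p) p"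


section \<open>Named notation for formulas\<close>

text \<open>
  To write concrete formulas with named bound variables, a formula is presented as a function of
  the number \<open>d\<close> of quantifiers it stands under, and a bound variable is represented by
  its level, i.e. the number of quantifiers outside the one that binds it.  At depth \<open>d\<close>
  the variable of level \<open>x\<close> has index \<open>d - 1 - x\<close>, where \<open>x < d\<close> for every
  variable in scope.  Applying the result to \<open>0\<close> gives the actual formula.
\<close>

type_synonym lvl = nat
type_synonym pfm = "nat \<Rightarrow> fm"

definition mem_p :: "lvl \<Rightarrow> lvl \<Rightarrow> pfm" (infix "\<^bold>\<in>" 50) where
  "(x \<^bold>\<in> y) d = Mem (d - 1 - x) (d - 1 - y)"

definition eq_p :: "lvl \<Rightarrow> lvl \<Rightarrow> pfm" (infix "\<^bold>=" 50) where
  "(x \<^bold>= y) d = Eq (d - 1 - x) (d - 1 - y)"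

definition imp_p :: "pfm \<Rightarrow> pfm \<Rightarrow> pfm" (infixr "\<^bold>\<longrightarrow>" 25) where
  "(P \<^bold>\<longrightarrow> Q) d = Imp (P d) (Q d)"

definition not_p :: "pfm \<Rightarrow> pfm" ("\<^bold>\<not> _" [40] 40) where
  "(\<^bold>\<not> P) d = Imp (P d) Fls"

definition and_p :: "pfm \<Rightarrow> pfm \<Rightarrow> pfm" (infixr "\<^bold>\<and>" 35) where
  "(P \<^bold>\<and> Q) = (\<^bold>\<not> (P \<^bold>\<longrightarrow> \<^bold>\<not> Q))"

definition or_p :: "pfm \<Rightarrow> pfm \<Rightarrow> pfm" (infixr "\<^bold>\<or>" 30) where
  "(P \<^bold>\<or> Q) = (\<^bold>\<not> P \<^bold>\<longrightarrow> Q)"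

definition iff_p :: "pfm \<Rightarrow> pfm \<Rightarrow> pfm" (infixr "\<^bold>\<longleftrightarrow>" 25) where
  "(P \<^bold>\<longleftrightarrow> Q) = ((P \<^bold>\<longrightarrow> Q) \<^bold>\<and> (Q \<^bold>\<longrightarrow> P))"

definition all_p :: "(lvl \<Rightarrow> pfm) \<Rightarrow> pfm" (binder "\<^bold>\<forall>" 10) where
  "(\<^bold>\<forall>x. P x) d = All (P d (Suc d))"

definition ex_p :: "(lvl \<Rightarrow> pfm) \<Rightarrow> pfm" (binder "\<^bold>\<exists>" 10) where
  "(\<^bold>\<exists>x. P x) = (\<^bold>\<not> (\<^bold>\<forall>x. \<^bold>\<not> P x))"

text \<open>
  For the axiom schemas: \<open>inst p [x\<^sub>0, \<dots>, x\<^sub>k]\<close> puts the bound variables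
  \<open>x\<^sub>0, \<dots>, x\<^sub>k\<close> for the indices \<open>0, \<dots>, k\<close> of the formula \<open>p\<close>;
  its remaining indices are shifted past the \<open>d\<close> enclosing quantifiers, and so
  are free parameters of the resulting formula that no quantifier in it captures.
\<close>

definition inst :: "fm \<Rightarrow> lvl list \<Rightarrow> pfm" where
  "inst p xs d = ren (\<lambda>i. if i < length xs then d - 1 - xs ! i else i - length xs + d) p"


section \<open>Set-theoretic notions\<close>

definition is_subset :: "lvl \<Rightarrow> lvl \<Rightarrow> pfm" where
  "is_subset x y = (\<^bold>\<forall>z. z \<^bold>\<in> x \<^bold>\<longrightarrow> z \<^bold>\<in> y)"

definition is_empty :: "lvl \<Rightarrow> pfm" where
  "is_empty x = (\<^bold>\<forall>z. \<^bold>\<not> z \<^bold>\<in> x)"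

text \<open>\<open>s = x \<union> {x}\<close>\<close>
definition is_succ :: "lvl \<Rightarrow> lvl \<Rightarrow> pfm" where
  "is_succ s x = (\<^bold>\<forall>z. z \<^bold>\<in> s \<^bold>\<longleftrightarrow> (z \<^bold>\<in> x \<^bold>\<or> z \<^bold>= x))"

definition is_inductive :: "lvl \<Rightarrow> pfm" where
  "is_inductive I =
     ((\<^bold>\<exists>e. is_empty e \<^bold>\<and> e \<^bold>\<in> I) \<^bold>\<and>
      (\<^bold>\<forall>x. x \<^bold>\<in> I \<^bold>\<longrightarrow> (\<^bold>\<exists>s. is_succ s x \<^bold>\<and> s \<^bold>\<in> I)))"

definition is_nat :: "lvl \<Rightarrow> pfm" where
  "is_nat n = (\<^bold>\<forall>I. is_inductive I \<^bold>\<longrightarrow> n \<^bold>\<in> I)"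

text \<open>\<open>p = {x, y}\<close>, where \<open>x = y\<close> is allowed\<close>
definition is_upair :: "lvl \<Rightarrow> lvl \<Rightarrow> lvl \<Rightarrow> pfm" where
  "is_upair p x y = (\<^bold>\<forall>z. z \<^bold>\<in> p \<^bold>\<longleftrightarrow> (z \<^bold>= x \<^bold>\<or> z \<^bold>= y))"

text \<open>\<open>p = {{x}, {x, y}}\<close>\<close>
definition is_opair :: "lvl \<Rightarrow> lvl \<Rightarrow> lvl \<Rightarrow> pfm" where
  "is_opair p x y = (\<^bold>\<exists>a. \<^bold>\<exists>b. is_upair a x x \<^bold>\<and> is_upair b x y \<^bold>\<and> is_upair p a b)"

definition upair_in :: "lvl \<Rightarrow> lvl \<Rightarrow> lvl \<Rightarrow> pfm" where
  "upair_in x y A = (\<^bold>\<exists>p. is_upair p x y \<^bold>\<and> p \<^bold>\<in> A)"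

definition opair_in :: "lvl \<Rightarrow> lvl \<Rightarrow> lvl \<Rightarrow> pfm" where
  "opair_in x y A = (\<^bold>\<exists>p. is_opair p x y \<^bold>\<and> p \<^bold>\<in> A)"

definition has_two_elements :: "lvl \<Rightarrow> pfm" where
  "has_two_elements A = (\<^bold>\<exists>x. \<^bold>\<exists>y. \<^bold>\<not> x \<^bold>= y \<^bold>\<and> is_upair A x y)"

definition is_fun_on :: "lvl \<Rightarrow> lvl \<Rightarrow> pfm" where
  "is_fun_on f X =
     ((\<^bold>\<forall>p. p \<^bold>\<in> f \<^bold>\<longrightarrow> (\<^bold>\<exists>x. \<^bold>\<exists>y. x \<^bold>\<in> X \<^bold>\<and> is_opair p x y)) \<^bold>\<and>
      (\<^bold>\<forall>x. x \<^bold>\<in> X \<^bold>\<longrightarrow> (\<^bold>\<exists>y. opair_in x y f)) \<^bold>\<and>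
      (\<^bold>\<forall>x. \<^bold>\<forall>y. \<^bold>\<forall>z. opair_in x y f \<^bold>\<and> opair_in x z f \<^bold>\<longrightarrow> y \<^bold>= z))"

definition is_fun :: "lvl \<Rightarrow> lvl \<Rightarrow> lvl \<Rightarrow> pfm" where
  "is_fun f X Y = (is_fun_on f X \<^bold>\<and> (\<^bold>\<forall>x. \<^bold>\<forall>y. opair_in x y f \<^bold>\<longrightarrow> y \<^bold>\<in> Y))"

definition is_bij :: "lvl \<Rightarrow> lvl \<Rightarrow> lvl \<Rightarrow> pfm" where
  "is_bij f X Y =
     (is_fun f X Y \<^bold>\<and>
      (\<^bold>\<forall>x. \<^bold>\<forall>x'. \<^bold>\<forall>y. opair_in x y f \<^bold>\<and> opair_in x' y f \<^bold>\<longrightarrow> x \<^bold>= x') \<^bold>\<and>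
      (\<^bold>\<forall>y. y \<^bold>\<in> Y \<^bold>\<longrightarrow> (\<^bold>\<exists>x. opair_in x y f)))"

definition is_finite :: "lvl \<Rightarrow> pfm" where
  "is_finite X = (\<^bold>\<exists>n. \<^bold>\<exists>f. is_nat n \<^bold>\<and> is_bij f n X)"


section \<open>The axioms of ZF\<close>

definition extensionality :: fm where
  "extensionality = (\<^bold>\<forall>x. \<^bold>\<forall>y. (\<^bold>\<forall>z. z \<^bold>\<in> x \<^bold>\<longleftrightarrow> z \<^bold>\<in> y) \<^bold>\<longrightarrow> x \<^bold>= y) 0"

definition foundation :: fm where
  "foundation =
     (\<^bold>\<forall>x. \<^bold>\<not> is_empty x \<^bold>\<longrightarrow>
        (\<^bold>\<exists>y. y \<^bold>\<in> x \<^bold>\<and> \<^bold>\<not> (\<^bold>\<exists>z. z \<^bold>\<in> x \<^bold>\<and> z \<^bold>\<in> y))) 0"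

definition pairing :: fm where
  "pairing = (\<^bold>\<forall>x. \<^bold>\<forall>y. \<^bold>\<exists>p. is_upair p x y) 0"

definition union :: fm where
  "union = (\<^bold>\<forall>a. \<^bold>\<exists>u. \<^bold>\<forall>x. x \<^bold>\<in> u \<^bold>\<longleftrightarrow> (\<^bold>\<exists>y. y \<^bold>\<in> a \<^bold>\<and> x \<^bold>\<in> y)) 0"

definition power_set :: fm where
  "power_set = (\<^bold>\<forall>a. \<^bold>\<exists>b. \<^bold>\<forall>x. x \<^bold>\<in> b \<^bold>\<longleftrightarrow> is_subset x a) 0"

definition infinity :: fm where
  "infinity = (\<^bold>\<exists>I. is_inductive I) 0"

definition separation :: "fm \<Rightarrow> fm" where
  "separation p =
     univ_closure ((\<^bold>\<forall>a. \<^bold>\<exists>b. \<^bold>\<forall>x. x \<^bold>\<in> b \<^bold>\<longleftrightarrow> (x \<^bold>\<in> a \<^bold>\<and> inst p [x, a])) 0)"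

definition replacement :: "fm \<Rightarrow> fm" where
  "replacement p =
     univ_closure
       ((\<^bold>\<forall>a.
          (\<^bold>\<forall>x. \<^bold>\<forall>y. \<^bold>\<forall>z.
             x \<^bold>\<in> a \<^bold>\<and> inst p [x, y, a] \<^bold>\<and> inst p [x, z, a] \<^bold>\<longrightarrow> y \<^bold>= z) \<^bold>\<longrightarrow>
          (\<^bold>\<exists>b. \<^bold>\<forall>y. y \<^bold>\<in> b \<^bold>\<longleftrightarrow> (\<^bold>\<exists>x. x \<^bold>\<in> a \<^bold>\<and> inst p [x, y, a]))) 0)"

definition ZF :: "fm set" where
  "ZF = {extensionality, foundation, pairing, union, power_set, infinity}
        \<union> range separation \<union> range replacement"


section \<open>Graphs\<close>

text \<open>
  A graph is given by its vertex set \<open>V\<close> and its edge set \<open>E\<close>, whose elements are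
  unordered pairs \<open>{u, v}\<close> of vertices; \<open>u = v\<close> is a loop.
\<close>

definition is_loop_graph :: "lvl \<Rightarrow> lvl \<Rightarrow> pfm" where
  "is_loop_graph V E =
     (\<^bold>\<forall>e. e \<^bold>\<in> E \<^bold>\<longrightarrow> (\<^bold>\<exists>u. \<^bold>\<exists>v. u \<^bold>\<in> V \<^bold>\<and> v \<^bold>\<in> V \<^bold>\<and> is_upair e u v))"

definition is_graph :: "lvl \<Rightarrow> lvl \<Rightarrow> pfm" where
  "is_graph V E = (is_loop_graph V E \<^bold>\<and> (\<^bold>\<forall>v. \<^bold>\<not> upair_in v v E))"

definition is_subgraph :: "lvl \<Rightarrow> lvl \<Rightarrow> lvl \<Rightarrow> lvl \<Rightarrow> pfm" where
  "is_subgraph V' E' V E = (is_graph V' E' \<^bold>\<and> is_subset V' V \<^bold>\<and> is_subset E' E)"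

definition is_hom :: "lvl \<Rightarrow> lvl \<Rightarrow> lvl \<Rightarrow> lvl \<Rightarrow> lvl \<Rightarrow> pfm" where
  "is_hom f V\<^sub>G E\<^sub>G V\<^sub>H E\<^sub>H =
     (is_fun f V\<^sub>G V\<^sub>H \<^bold>\<and>
      (\<^bold>\<forall>u. \<^bold>\<forall>v. \<^bold>\<forall>x. \<^bold>\<forall>y.
         upair_in u v E\<^sub>G \<^bold>\<and> opair_in u x f \<^bold>\<and> opair_in v y f \<^bold>\<longrightarrow> upair_in x y E\<^sub>H))"


section \<open>The two principles\<close>

definition P_G_H2 :: pfm where
  "P_G_H2 =
     (\<^bold>\<forall>V\<^sub>G. \<^bold>\<forall>E\<^sub>G. \<^bold>\<forall>V\<^sub>H. \<^bold>\<forall>E\<^sub>H.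
        is_graph V\<^sub>G E\<^sub>G \<^bold>\<and> \<^bold>\<not> is_finite V\<^sub>G \<^bold>\<and>
        is_loop_graph V\<^sub>H E\<^sub>H \<^bold>\<and> is_finite V\<^sub>H \<^bold>\<and> has_two_elements V\<^sub>H \<^bold>\<and>
        (\<^bold>\<forall>V\<^sub>F. \<^bold>\<forall>E\<^sub>F. is_subgraph V\<^sub>F E\<^sub>F V\<^sub>G E\<^sub>G \<^bold>\<and> is_finite V\<^sub>F \<^bold>\<longrightarrow>
           (\<^bold>\<exists>f. is_hom f V\<^sub>F E\<^sub>F V\<^sub>H E\<^sub>H)) \<^bold>\<longrightarrow>
        (\<^bold>\<exists>f. is_hom f V\<^sub>G E\<^sub>G V\<^sub>H E\<^sub>H))"

definition AC2 :: pfm where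
  "AC2 =
     (\<^bold>\<forall>A. (\<^bold>\<forall>p. p \<^bold>\<in> A \<^bold>\<longrightarrow> has_two_elements p) \<^bold>\<longrightarrow>
        (\<^bold>\<exists>f. is_fun_on f A \<^bold>\<and> (\<^bold>\<forall>p. \<^bold>\<forall>x. opair_in p x f \<^bold>\<longrightarrow> x \<^bold>\<in> p)))"

end

(*
  A Henkin-style completeness theorem reduces derivability to truth in all models; a model of ZF
  has infinitely many elements, so its domain, modulo the interpretation of equality, can be taken
  to be the type of natural numbers with genuine equality, and one can argue inside that model.

  From AC_2 to P: if H has a loop or G has no edges, a constant map is a homomorphism; otherwise
  homomorphisms into H give proper 2-colourings of the finite subgraphs of G.  Two vertices are linked if
  some finite subgraph forces their colours to agree or forces them to differ.  The set of vertices
  forced to agree with x and the set of those forced to differ from x form an unordered pair that depends only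
  on the class of x under linking, and a choice from these pairs is a 2-colouring of G.

  From P to AC_2: given a family A of pairs, take as edges the pairs {(x, p), (y, p)}
  for p = {x, y} in A.  Finite subgraphs are 2-colourable by induction, and a
  2-colouring of the whole graph selects one element of each p.  If the graph is finite, P does not apply, but
  the induction already colours the whole graph.
*)
theory Submission
  imports Defs "HOL-Library.Countable_Set"
begin

text \<open>Supplies the enumeration \<open>from_nat\<close> of all formulas along which the Henkin
  construction proceeds.\<close>

instance fm :: countable
  by countable_datatype

section \<open>Renaming\<close>

primrec fv :: "fm \<Rightarrow> nat set" where
  "fv (Mem i j) = {i, j}"
| "fv (Eq i j) = {i, j}"
| "fv Fls = {}"
| "fv (Imp p q) = fv p \<union> fv q"
| "fv (All p) = {i. Suc i \<in> fv p}"

lemma finite_fv: "finite (fv p)"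
proof (induction p)
  case (All p)
  then show ?case
    using finite_vimageI[of "fv p" Suc] by (simp add: vimage_def)
qed auto

lemma fv_less_fv_bound: "i \<in> fv p \<Longrightarrow> i < fv_bound p"
proof (induction p arbitrary: i)
  case (All p)
  then have "Suc i < fv_bound p" by simp
  then show ?case by simp
qed (auto simp: less_max_iff_disj)

lemma ren_cong: "(\<And>i. i \<in> fv p \<Longrightarrow> r i = s i) \<Longrightarrow> ren r p = ren s p"
proof (induction p arbitrary: r s)
  case (All p)
  have "ren (case_nat 0 (\<lambda>i. Suc (r i))) p = ren (case_nat 0 (\<lambda>i. Suc (s i))) p"
    by (rule All.IH) (auto simp: All.prems split: nat.split)
  then show ?case by simp
next
  case (Imp p q)
  have "ren r p = ren s p" "ren r q = ren s q"
    by (rule Imp.IH; simp add: Imp.prems)+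
  then show ?case by simp
qed simp_all

lemma ren_ren: "ren r (ren s p) = ren (\<lambda>i. r (s i)) p"
proof (induction p arbitrary: r s)
  case (All p)
  show ?case
    by (simp add: All.IH) (intro ren_cong, simp split: nat.split)
qed auto

lemma ren_id: "ren (\<lambda>i. i) p = p"
proof (induction p)
  case (All p)
  have "ren (case_nat 0 Suc) p = ren (\<lambda>i. i) p"
    by (intro ren_cong) (simp split: nat.split)
  then show ?case using All by simp
qed auto

text \<open>Lifting a renaming under a binder and then instantiating amounts to one renaming that
  sends 0 to \<open>t\<close>; quantifiers enter \<open>ren_subst0\<close> and the truth lemma in
  this way.\<close>

lemma subst0_ren: "subst0 t (ren (case_nat 0 (\<lambda>i. Suc (r i))) p) = ren (case_nat t r) p"
  unfolding subst0_def ren_ren by (intro ren_cong) (simp split: nat.split)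

lemma ren_subst0: "ren r (subst0 t p) = subst0 (r t) (ren (case_nat 0 (\<lambda>i. Suc (r i))) p)"
  unfolding subst0_ren unfolding subst0_def ren_ren by (intro ren_cong) (simp split: nat.split)

section \<open>Structural properties of derivability\<close>

lemma weaken: "\<Gamma> \<turnstile> p \<Longrightarrow> \<Gamma> \<subseteq> \<Delta> \<Longrightarrow> \<Delta> \<turnstile> p"
proof (induction arbitrary: \<Delta> rule: derivable.induct)
  case (ImpI p \<Gamma> q)
  have "insert p \<Delta> \<turnstile> q" by (rule ImpI.IH) (use ImpI.prems in auto)
  then show ?case by (rule derivable.ImpI)
next
  case (Classical p \<Gamma>)
  have "insert (Imp p Fls) \<Delta> \<turnstile> Fls" by (rule Classical.IH) (use Classical.prems in auto)
  then show ?case by (rule derivable.Classical)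
next
  case (AllI \<Gamma> p)
  then show ?case by (intro derivable.AllI) (simp add: image_mono)
next
  case (EqSubst \<Gamma> s t p)
  then show ?case by (intro derivable.EqSubst[of _ s t p]) auto
qed (auto intro: derivable.Assm derivable.ImpE derivable.AllE derivable.EqRefl)

text \<open>A derivation touches only finitely many assumptions; this keeps the union of the Henkin
  stages consistent.\<close>

lemma finite_support: "\<Gamma> \<turnstile> p \<Longrightarrow> \<exists>\<Delta>. finite \<Delta> \<and> \<Delta> \<subseteq> \<Gamma> \<and> \<Delta> \<turnstile> p"
proof (induction rule: derivable.induct)
  case (Assm p \<Gamma>)
  then show ?case by (intro exI[of _ "{p}"]) (auto intro: derivable.Assm)
next
  case (ImpI p \<Gamma> q)
  then obtain \<Delta> where "finite \<Delta>" "\<Delta> \<subseteq> insert p \<Gamma>" "\<Delta> \<turnstile> q" by blast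
  then show ?case
    by (intro exI[of _ "\<Delta> - {p}"] conjI derivable.ImpI weaken[OF \<open>\<Delta> \<turnstile> q\<close>]) auto
next
  case (ImpE \<Gamma> p q)
  then obtain \<Delta> \<Delta>' where "finite \<Delta>" "\<Delta> \<subseteq> \<Gamma>" "\<Delta> \<turnstile> Imp p q"
    and "finite \<Delta>'" "\<Delta>' \<subseteq> \<Gamma>" "\<Delta>' \<turnstile> p" by blast
  then show ?case
    by (intro exI[of _ "\<Delta> \<union> \<Delta>'"] conjI derivable.ImpE[of _ p q] weaken[OF \<open>\<Delta> \<turnstile> Imp p q\<close>]
      weaken[OF \<open>\<Delta>' \<turnstile> p\<close>]) auto
next
  case (Classical p \<Gamma>)
  then obtain \<Delta> where "finite \<Delta>" "\<Delta> \<subseteq> insert (Imp p Fls) \<Gamma>" "\<Delta> \<turnstile> Fls" by blast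
  then show ?case
    using derivable.Classical[of p "\<Delta> - {Imp p Fls}", OF weaken[OF \<open>\<Delta> \<turnstile> Fls\<close>]]
    by (intro exI[of _ "\<Delta> - {Imp p Fls}"]) auto
next
  case (AllI \<Gamma> p)
  then obtain \<Delta> where "finite \<Delta>" "\<Delta> \<subseteq> ren Suc ` \<Gamma>" "\<Delta> \<turnstile> p" by blast
  \<comment> \<open>The finite support consists of shifted formulas, so it is the shift of a finite
    part of \<open>\<Gamma>\<close>.\<close>
  then show ?case
    using finite_subset_image[of \<Delta> "ren Suc" \<Gamma>] by (auto intro: derivable.AllI)
next
  case (AllE \<Gamma> p t)
  then obtain \<Delta> where "finite \<Delta>" "\<Delta> \<subseteq> \<Gamma>" "\<Delta> \<turnstile> All p" by blast
  then show ?case by (intro exI[of _ \<Delta>] conjI derivable.AllE)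
next
  case (EqRefl \<Gamma> t)
  then show ?case by (intro exI[of _ "{}"]) (auto intro: derivable.EqRefl)
next
  case (EqSubst \<Gamma> s t p)
  then obtain \<Delta> \<Delta>' where "finite \<Delta>" "\<Delta> \<subseteq> \<Gamma>" "\<Delta> \<turnstile> Eq s t"
    and "finite \<Delta>'" "\<Delta>' \<subseteq> \<Gamma>" "\<Delta>' \<turnstile> subst0 s p" by blast
  then show ?case
    by (intro exI[of _ "\<Delta> \<union> \<Delta>'"] conjI derivable.EqSubst[of _ s t p] weaken[OF \<open>\<Delta> \<turnstile> Eq s t\<close>]
      weaken[OF \<open>\<Delta>' \<turnstile> subst0 s p\<close>]) auto
qed

text \<open>Holds for every renaming, injective or not, because its lift under a binder commutes
  with the shift \<open>ren Suc\<close> of the context.\<close>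

lemma derivable_ren: "\<Gamma> \<turnstile> p \<Longrightarrow> ren r ` \<Gamma> \<turnstile> ren r p"
proof (induction arbitrary: r rule: derivable.induct)
  case (AllI \<Gamma> p)
  have "ren (case_nat 0 (\<lambda>i. Suc (r i))) ` ren Suc ` \<Gamma> = ren Suc ` ren r ` \<Gamma>"
    by (simp add: image_image ren_ren)
  with AllI.IH[of "case_nat 0 (\<lambda>i. Suc (r i))"] show ?case
    by (simp add: derivable.AllI)
next
  case (AllE \<Gamma> p t)
  then show ?case by (simp add: ren_subst0 derivable.AllE)
next
  case (EqSubst \<Gamma> s t p)
  then show ?case unfolding ren_subst0 by (intro derivable.EqSubst[of _ "r s" "r t"]) auto
next
  case (ImpE \<Gamma> p q)
  then show ?case using derivable.ImpE[of _ "ren r p"] by simp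
qed (auto intro: derivable.Assm derivable.ImpI derivable.Classical derivable.EqRefl)

text \<open>This is \<open>AllI\<close> with a named eigenvariable \<open>y\<close>. The renaming
  that sends \<open>y\<close> to 0 and moves everything else up acts on the context as the shift and
  undoes the instantiation of \<open>p\<close>.\<close>

lemma generalize:
  assumes "\<Gamma> \<turnstile> subst0 y p" and fresh: "\<And>q. q \<in> \<Gamma> \<Longrightarrow> y \<notin> fv q" "y \<notin> fv (All p)"
  shows "\<Gamma> \<turnstile> All p"
proof (rule AllI)
  let ?r = "\<lambda>i. if i = y then 0 else Suc i"
  have "ren ?r ` \<Gamma> = ren Suc ` \<Gamma>"
    by (intro image_cong refl ren_cong) (use fresh(1) in auto)
  moreover have "ren ?r (subst0 y p) = ren (\<lambda>i. i) p"
    unfolding subst0_def ren_ren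
    by (intro ren_cong) (use fresh(2) in \<open>auto split: nat.split\<close>)
  ultimately show "ren Suc ` \<Gamma> \<turnstile> p"
    using derivable_ren[OF assms(1), of ?r] by (simp add: ren_id)
qed

section \<open>Satisfaction and completeness\<close>

text \<open>\<open>Eq\<close> is read as a relation \<open>Q\<close> because the term model only
  yields a congruence; the quotient by it is taken afterwards.\<close>

primrec sat :: "('a \<Rightarrow> 'a \<Rightarrow> bool) \<Rightarrow> ('a \<Rightarrow> 'a \<Rightarrow> bool) \<Rightarrow> (nat \<Rightarrow> 'a) \<Rightarrow> fm \<Rightarrow> bool" where
  "sat E Q v (Mem i j) \<longleftrightarrow> E (v i) (v j)"
| "sat E Q v (Eq i j) \<longleftrightarrow> Q (v i) (v j)"
| "sat E Q v Fls \<longleftrightarrow> False"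
| "sat E Q v (Imp p q) \<longleftrightarrow> (sat E Q v p \<longrightarrow> sat E Q v q)"
| "sat E Q v (All p) \<longleftrightarrow> (\<forall>a. sat E Q (case_nat a v) p)"

lemma sat_cong: "(\<And>i. i \<in> fv p \<Longrightarrow> v i = w i) \<Longrightarrow> sat E Q v p = sat E Q w p"
proof (induction p arbitrary: v w)
  case (All p)
  have "sat E Q (case_nat a v) p = sat E Q (case_nat a w) p" for a
    by (rule All.IH) (auto simp: All.prems split: nat.split)
  then show ?case by simp
next
  case (Imp p q)
  have "sat E Q v p = sat E Q w p" "sat E Q v q = sat E Q w q"
    by (rule Imp.IH; simp add: Imp.prems)+
  then show ?case by simp
qed simp_all

lemma sat_ren: "sat E Q v (ren r p) = sat E Q (\<lambda>i. v (r i)) p"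
proof (induction p arbitrary: v r)
  case (All p)
  show ?case
    by (simp add: All.IH) (intro iff_allI sat_cong, simp split: nat.split)
qed auto

lemma sat_univ_closure:
  assumes "sat E Q v (univ_closure p)"
  shows "sat E Q w p"
proof -
  \<comment> \<open>Quantifiers are peeled off from the outside: the outermost of
    \<open>Suc k\<close> quantifiers binds what becomes index \<open>k\<close> inside, hence the
    value \<open>u k\<close>.\<close>
  have gen: "sat E Q u q" if "sat E Q v ((All ^^ k) q)" "\<And>i. u (i + k) = v i" for u k q
    using that
  proof (induction k arbitrary: v)
    case 0
    then have "u = v" by (intro ext) simp
    then show ?case using 0 by simp
  next
    case (Suc k)
    have "sat E Q (case_nat (u k) v) ((All ^^ k) q)" using Suc.prems(1) by simp
    moreover have "u (i + k) = case_nat (u k) v i" for i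
      using Suc.prems(2) by (cases i) auto
    ultimately show ?case by (rule Suc.IH)
  qed
  \<comment> \<open>Beyond \<open>fv_bound p\<close> the assignment continues with \<open>v\<close>,
    as \<open>gen\<close> demands; below it lie all free variables of \<open>p\<close>.\<close>
  let ?u = "\<lambda>i. if i < fv_bound p then w i else v (i - fv_bound p)"
  have "sat E Q ?u p"
    by (rule gen[of "fv_bound p"]) (use assms in \<open>simp_all add: univ_closure_def\<close>)
  then show ?thesis
    using sat_cong[of p ?u w E Q] fv_less_fv_bound by simp
qed

definition congruence :: "('a \<Rightarrow> 'a \<Rightarrow> bool) \<Rightarrow> ('a \<Rightarrow> 'a \<Rightarrow> bool) \<Rightarrow> bool" where
  "congruence E Q \<longleftrightarrow> equivp Q \<and> (\<forall>a a' b b'. Q a a' \<longrightarrow> Q b b' \<longrightarrow> E a b \<longrightarrow> E a' b')"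

text \<open>Since terms are variables, variables that are fresh for everything used so far serve as
  Henkin witnesses.\<close>

definition henkin_witness :: "fm set \<Rightarrow> fm \<Rightarrow> fm set" where
  "henkin_witness S p = (case p of
     Imp (All q) Fls \<Rightarrow>
       {Imp (subst0 (SOME y. y \<notin> fv q \<and> y \<notin> fv (All q) \<and> y \<notin> (\<Union>p\<in>S. fv p)) q) Fls}
   | _ \<Rightarrow> {})"

text \<open>Maximality and witnesses are arranged in a single recursion. Stage \<open>n\<close>
  treats formula number \<open>n\<close>, so each stage uses finitely many new variables and fresh
  ones remain.\<close>

primrec henkin :: "fm set \<Rightarrow> nat \<Rightarrow> fm set" where
  "henkin \<Gamma> 0 = \<Gamma>"
| "henkin \<Gamma> (Suc n) = (let p = from_nat n; S = henkin \<Gamma> n in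
     if insert p S \<turnstile> Fls then S else insert p S \<union> henkin_witness S p)"

lemma derivable_cut: "insert p \<Gamma> \<turnstile> q \<Longrightarrow> \<Gamma> \<turnstile> p \<Longrightarrow> \<Gamma> \<turnstile> q"
  by (rule ImpE[OF ImpI])

lemma derivable_exfalso: "\<Gamma> \<turnstile> Fls \<Longrightarrow> \<Gamma> \<turnstile> p"
  by (rule Classical, erule weaken, rule subset_insertI)

lemma finite_fv_henkin_witness: "finite (\<Union>q\<in>henkin_witness S p. fv q)"
  by (simp add: henkin_witness_def finite_fv split: fm.split)

text \<open>If the negated instance at the fresh \<open>y\<close> were refutable, the instance
  itself would be derivable; generalizing over \<open>y\<close> would give \<open>All q\<close>,
  against \<open>p\<close>.\<close>

lemma henkin_witness_consistent:
  assumes fin: "finite (\<Union>q\<in>S. fv q)" and con: "\<not> insert p S \<turnstile> Fls"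
  shows "\<not> insert p S \<union> henkin_witness S p \<turnstile> Fls"
proof (cases "\<exists>q. p = Imp (All q) Fls")
  case True
  then obtain q where p: "p = Imp (All q) Fls" by blast
  define y where "y = (SOME y. y \<notin> fv q \<and> y \<notin> fv (All q) \<and> y \<notin> (\<Union>p\<in>S. fv p))"
  have "finite (fv q \<union> fv (All q) \<union> (\<Union>p\<in>S. fv p))"
    using fin finite_fv by blast
  from ex_new_if_finite[OF infinite_UNIV_nat this]
  have "\<exists>y. y \<notin> fv q \<and> y \<notin> fv (All q) \<and> y \<notin> (\<Union>p\<in>S. fv p)" by blast
  from someI_ex[OF this]
  have "y \<notin> fv q \<and> y \<notin> fv (All q) \<and> y \<notin> (\<Union>p\<in>S. fv p)" unfolding y_def .
  then have fresh: "y \<notin> fv (All q)" "\<And>r. r \<in> insert p S \<Longrightarrow> y \<notin> fv r" using p by auto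
  show ?thesis
  proof
    assume "insert p S \<union> henkin_witness S p \<turnstile> Fls"
    then have "insert (Imp (subst0 y q) Fls) (insert p S) \<turnstile> Fls"
      by (simp only: p henkin_witness_def fm.case y_def[symmetric] Un_insert_right Un_empty_right)
    then have "insert p S \<turnstile> subst0 y q" by (rule Classical)
    then have "insert p S \<turnstile> All q" by (rule generalize) (use fresh in blast)+
    moreover have "insert p S \<turnstile> Imp (All q) Fls" by (rule Assm) (simp add: p)
    ultimately have "insert p S \<turnstile> Fls" by (rule ImpE[rotated])
    with con show False by blast
  qed
next
  case False
  then have "henkin_witness S p = {}" by (simp add: henkin_witness_def split: fm.split)
  then show ?thesis using con by simp
qed

lemma henkin_extension:
  assumes con: "\<not> \<Gamma> \<turnstile> Fls" and fin: "finite (\<Union>q\<in>\<Gamma>. fv q)"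
  obtains M where "\<Gamma> \<subseteq> M" "\<not> M \<turnstile> Fls" "\<And>p. \<not> insert p M \<turnstile> Fls \<Longrightarrow> p \<in> M"
    "\<And>q. Imp (All q) Fls \<in> M \<Longrightarrow> \<exists>y. Imp (subst0 y q) Fls \<in> M"
proof
  let ?M = "\<Union>n. henkin \<Gamma> n"
  show "\<Gamma> \<subseteq> ?M" by (metis UN_upper UNIV_I henkin.simps(1))
  have inc: "henkin \<Gamma> n \<subseteq> henkin \<Gamma> m" if "n \<le> m" for n m
    by (rule lift_Suc_mono_le[OF _ that]) (auto simp: Let_def)
  have "finite (\<Union>q\<in>henkin \<Gamma> n. fv q) \<and> \<not> henkin \<Gamma> n \<turnstile> Fls" for n
  proof (induction n)
    case (Suc n)
    have "finite (\<Union>q\<in>henkin \<Gamma> (Suc n). fv q)"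
      using Suc finite_fv finite_fv_henkin_witness by (simp add: Let_def)
    moreover have "\<not> henkin \<Gamma> (Suc n) \<turnstile> Fls"
      using Suc henkin_witness_consistent[of "henkin \<Gamma> n"] by (simp add: Let_def)
    ultimately show ?case by blast
  qed (use con fin in simp)
  then have con': "\<not> henkin \<Gamma> n \<turnstile> Fls" for n by blast
  show conM: "\<not> ?M \<turnstile> Fls"
  proof
    assume "?M \<turnstile> Fls"
    then obtain \<Delta> where \<Delta>: "finite \<Delta>" "\<Delta> \<subseteq> ?M" "\<Delta> \<turnstile> Fls" using finite_support by blast
    \<comment> \<open>The stages increase, so finitely many assumptions already lie in one of
      them.\<close>
    from \<Delta>(1,2) have "\<exists>n. \<Delta> \<subseteq> henkin \<Gamma> n"
    proof (induction rule: finite_induct)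
      case (insert p \<Delta>)
      then obtain n m where "\<Delta> \<subseteq> henkin \<Gamma> n" "p \<in> henkin \<Gamma> m" by auto
      then have "insert p \<Delta> \<subseteq> henkin \<Gamma> (max n m)"
        using inc[of n "max n m"] inc[of m "max n m"] by auto
      then show ?case by blast
    qed simp
    then show False using weaken[OF \<Delta>(3)] con' by blast
  qed
  \<comment> \<open>The formula \<open>p\<close> is treated at stage \<open>to_nat p\<close>;
    consistency with the union implies consistency with that stage.\<close>
  have step: "insert p (henkin \<Gamma> (to_nat p)) \<union> henkin_witness (henkin \<Gamma> (to_nat p)) p \<subseteq> ?M"
    if "\<not> insert p ?M \<turnstile> Fls" for p
  proof -
    have "\<not> insert p (henkin \<Gamma> (to_nat p)) \<turnstile> Fls"
      using that weaken[of "insert p (henkin \<Gamma> (to_nat p))" Fls "insert p ?M"] by blast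
    then have "henkin \<Gamma> (Suc (to_nat p))
        = insert p (henkin \<Gamma> (to_nat p)) \<union> henkin_witness (henkin \<Gamma> (to_nat p)) p"
      by (simp add: Let_def)
    then show ?thesis by blast
  qed
  show "p \<in> ?M" if "\<not> insert p ?M \<turnstile> Fls" for p
    using step[OF that] by simp
  show "\<exists>y. Imp (subst0 y q) Fls \<in> ?M" if "Imp (All q) Fls \<in> ?M" for q
  proof -
    have "\<not> insert (Imp (All q) Fls) ?M \<turnstile> Fls"
      using conM that by (simp add: insert_absorb)
    from step[OF this] show ?thesis by (auto simp: henkin_witness_def)
  qed
qed

text \<open>A non-derivable \<open>p\<close> has a countermodel: its elements are the variables, a
  maximal Henkin theory \<open>M\<close> containing the negation of \<open>p\<close> decides the
  atomic formulas, and the assignment is the identity.\<close>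

theorem completeness:
  assumes fin: "finite (\<Union>q\<in>\<Gamma>. fv q)"
    and valid: "\<And>E Q (v :: nat \<Rightarrow> nat). congruence E Q \<Longrightarrow> \<forall>q\<in>\<Gamma>. sat E Q v q \<Longrightarrow> sat E Q v p"
  shows "\<Gamma> \<turnstile> p"
proof (rule ccontr)
  assume "\<not> \<Gamma> \<turnstile> p"
  then have "\<not> insert (Imp p Fls) \<Gamma> \<turnstile> Fls" using Classical by blast
  moreover have "finite (\<Union>q\<in>insert (Imp p Fls) \<Gamma>. fv q)" using fin finite_fv by simp
  ultimately obtain M where M: "insert (Imp p Fls) \<Gamma> \<subseteq> M" and con: "\<not> M \<turnstile> Fls"
    and max: "\<And>q. \<not> insert q M \<turnstile> Fls \<Longrightarrow> q \<in> M"
    and wit: "\<And>q. Imp (All q) Fls \<in> M \<Longrightarrow> \<exists>y. Imp (subst0 y q) Fls \<in> M"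
    by (rule henkin_extension) blast
  have closed: "q \<in> M" if "M \<turnstile> q" for q
    using max[of q] derivable_cut[OF _ that] con by blast
  have neg: "Imp q Fls \<in> M \<longleftrightarrow> q \<notin> M" for q
  proof
    assume "Imp q Fls \<in> M"
    then show "q \<notin> M" using con ImpE[OF Assm Assm] by blast
  next
    assume "q \<notin> M"
    then have "insert q M \<turnstile> Fls" using max by blast
    then show "Imp q Fls \<in> M" by (intro closed ImpI)
  qed
  have imp: "Imp q r \<in> M \<longleftrightarrow> (q \<in> M \<longrightarrow> r \<in> M)" for q r
  proof
    assume "q \<in> M \<longrightarrow> r \<in> M"
    then have "insert q M \<turnstile> r"
    proof (cases "q \<in> M")
      case False
      then have "insert q M \<turnstile> Fls" using max by blast
      then show ?thesis by (rule derivable_exfalso)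
    qed (auto intro: Assm)
    then show "Imp q r \<in> M" by (intro closed ImpI)
  next
    assume "Imp q r \<in> M"
    then show "q \<in> M \<longrightarrow> r \<in> M" using closed[OF ImpE[OF Assm Assm]] by blast
  qed
  have all: "All q \<in> M \<longleftrightarrow> (\<forall>t. subst0 t q \<in> M)" for q
  proof
    assume "All q \<in> M"
    then have "M \<turnstile> All q" by (rule Assm)
    then show "\<forall>t. subst0 t q \<in> M" by (intro allI closed AllE)
  next
    assume "\<forall>t. subst0 t q \<in> M"
    \<comment> \<open>Otherwise maximality puts the negation of \<open>All q\<close> into
      \<open>M\<close>, and its witness refutes one of the instances.\<close>
    then show "All q \<in> M" using wit[of q] neg by blast
  qed
  define E where "E i j \<longleftrightarrow> Mem i j \<in> M" for i j
  define Q where "Q i j \<longleftrightarrow> Eq i j \<in> M" for i j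
  have subst: "subst0 t q \<in> M" if "Q s t" "subst0 s q \<in> M" for s t q
    by (rule closed, rule EqSubst[of _ s]) (use that in \<open>auto simp: Q_def intro: Assm\<close>)
  have "Q i i" for i
    unfolding Q_def by (intro closed EqRefl)
  moreover have "Q j i" if "Q i j" for i j
    \<comment> \<open>In the formula handed to \<open>subst\<close>, index 0 marks the place of
      replacement, while \<open>Suc i\<close> comes out as the variable \<open>i\<close>.\<close>
    using subst[OF that, of "Eq 0 (Suc i)"] \<open>Q i i\<close> by (simp add: subst0_def Q_def)
  moreover have "Q i k" if "Q i j" "Q j k" for i j k
    using subst[OF that(2), of "Eq (Suc i) 0"] that(1) by (simp add: subst0_def Q_def)
  ultimately have "equivp Q" by (intro equivpI reflpI sympI transpI)
  moreover have "E a' b'" if "Q a a'" "Q b b'" "E a b" for a a' b b'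
    using subst[OF that(1), of "Mem 0 (Suc b)"] subst[OF that(2), of "Mem (Suc a') 0"] that(3)
    by (simp add: subst0_def E_def)
  ultimately have "congruence E Q" unfolding congruence_def by blast
  \<comment> \<open>An assignment of variables to variables is itself a renaming; letting it vary
    carries the induction under quantifiers.\<close>
  moreover have truth: "sat E Q v q \<longleftrightarrow> ren v q \<in> M" for v q
  proof (induction q arbitrary: v)
    case Fls
    then show ?case using con Assm by auto
  qed (simp_all add: E_def Q_def imp all subst0_ren)
  moreover have "\<forall>q\<in>\<Gamma>. sat E Q (\<lambda>i. i) q" using M by (auto simp: truth ren_id)
  ultimately have "sat E Q (\<lambda>i. i) p" using valid by blast
  then have "p \<in> M" by (simp add: truth ren_id)
  then show False using M neg by blast
qed

text \<open>Quantifiers agree because every element of the target is an image. With \<open>h\<close>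
  numbering equivalence classes, this replaces \<open>Q\<close> by true equality.\<close>

lemma sat_surj:
  assumes "surj h" "\<And>i j. Q i j \<longleftrightarrow> Q' (h i) (h j)" "\<And>i j. E i j \<longleftrightarrow> E' (h i) (h j)"
  shows "sat E Q v p \<longleftrightarrow> sat E' Q' (\<lambda>i. h (v i)) p"
proof (induction p arbitrary: v)
  case (All p)
  have "(\<lambda>i. h (case_nat a v i)) = case_nat (h a) (\<lambda>i. h (v i))" for a
    by (intro ext) (simp split: nat.split)
  then have "sat E Q v (All p) \<longleftrightarrow> (\<forall>a. sat E' Q' (case_nat (h a) (\<lambda>i. h (v i))) p)"
    by (simp add: All.IH)
  also have "\<dots> \<longleftrightarrow> sat E' Q' (\<lambda>i. h (v i)) (All p)"
    using \<open>surj h\<close> by (simp, metis surj_def)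
  finally show ?case .
qed (use assms in simp_all)

section \<open>Satisfaction of formulas in named notation\<close>

text \<open>The list gives the values of the levels, outermost first; \<open>v\<close> gives the free parameters.\<close>

definition env :: "(nat \<Rightarrow> 'a) \<Rightarrow> 'a list \<Rightarrow> nat \<Rightarrow> 'a" where
  "env v vs i = (if i < length vs then vs ! (length vs - 1 - i) else v (i - length vs))"

definition holds :: "('a \<Rightarrow> 'a \<Rightarrow> bool) \<Rightarrow> ('a \<Rightarrow> 'a \<Rightarrow> bool) \<Rightarrow> (nat \<Rightarrow> 'a) \<Rightarrow> 'a list \<Rightarrow> pfm \<Rightarrow> bool"
  where "holds E Q v vs P \<longleftrightarrow> sat E Q (env v vs) (P (length vs))"

lemma env_Nil [simp]: "env v [] = v"
  by (simp add: env_def fun_eq_iff)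

text \<open>A new innermost variable has index 0 but the highest level, so its value goes to the end
  of the list.\<close>

lemma case_nat_env: "case_nat a (env v vs) = env v (vs @ [a])"
  by (auto simp: env_def fun_eq_iff nth_append split: nat.split)

lemma env_level: 
  assumes "x < length vs"
  shows "env v vs (length vs - 1 - x) = vs ! x"
proof -
  have "length vs - 1 - x < length vs" "length vs - 1 - (length vs - 1 - x) = x"
    using assms by arith+
  then show ?thesis by (simp only: env_def if_True)
qed

lemma sat_closed: "sat E Q v (P 0) \<longleftrightarrow> holds E Q v [] P"
  by (simp add: holds_def)

lemma holds_mem [simp]:
  "x < length vs \<Longrightarrow> y < length vs \<Longrightarrow> holds E Q v vs (x \<^bold>\<in> y) \<longleftrightarrow> E (vs ! x) (vs ! y)"
  unfolding holds_def mem_p_def by (simp add: env_level[simplified])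

lemma holds_eq [simp]:
  "x < length vs \<Longrightarrow> y < length vs \<Longrightarrow> holds E Q v vs (x \<^bold>= y) \<longleftrightarrow> Q (vs ! x) (vs ! y)"
  unfolding holds_def eq_p_def by (simp add: env_level[simplified])

lemma holds_imp [simp]: "holds E Q v vs (P \<^bold>\<longrightarrow> R) \<longleftrightarrow> (holds E Q v vs P \<longrightarrow> holds E Q v vs R)"
  by (simp add: holds_def imp_p_def)

lemma holds_not [simp]: "holds E Q v vs (\<^bold>\<not> P) \<longleftrightarrow> \<not> holds E Q v vs P"
  by (simp add: holds_def not_p_def)

lemma holds_and [simp]: "holds E Q v vs (P \<^bold>\<and> R) \<longleftrightarrow> holds E Q v vs P \<and> holds E Q v vs R"
  by (simp add: and_p_def)

lemma holds_or [simp]: "holds E Q v vs (P \<^bold>\<or> R) \<longleftrightarrow> holds E Q v vs P \<or> holds E Q v vs R"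
  by (auto simp: or_p_def)

lemma holds_iff [simp]: "holds E Q v vs (P \<^bold>\<longleftrightarrow> R) \<longleftrightarrow> (holds E Q v vs P \<longleftrightarrow> holds E Q v vs R)"
  by (auto simp: iff_p_def)

lemma holds_all [simp]:
  "holds E Q v vs (\<^bold>\<forall>x. P x) \<longleftrightarrow> (\<forall>a. holds E Q v (vs @ [a]) (P (length vs)))"
  by (simp add: holds_def all_p_def case_nat_env)

lemma holds_ex [simp]:
  "holds E Q v vs (\<^bold>\<exists>x. P x) \<longleftrightarrow> (\<exists>a. holds E Q v (vs @ [a]) (P (length vs)))"
  by (simp add: ex_p_def)

text \<open>Indices beyond \<open>xs\<close> are moved past the quantified values, so they read the
  parameters straight from \<open>v\<close>.\<close>

lemma holds_inst:
  "(\<forall>x\<in>set xs. x < length vs) \<Longrightarrow>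
    holds E Q v vs (inst p xs) \<longleftrightarrow> sat E Q (\<lambda>i. if i < length xs then vs ! (xs ! i) else v (i - length xs)) p"
  unfolding holds_def inst_def sat_ren
proof (intro sat_cong)
  fix i
  assume xs: "\<forall>x\<in>set xs. x < length vs"
  show "env v vs (if i < length xs then length vs - 1 - xs ! i else i - length xs + length vs)
    = (if i < length xs then vs ! (xs ! i) else v (i - length xs))"
    using xs env_level[of "xs ! i" vs v] by (auto simp: env_def)
qed

lemma holds_is_subset [simp]:
  "x < length vs \<Longrightarrow> y < length vs \<Longrightarrow>
    holds E Q v vs (is_subset x y) \<longleftrightarrow> (\<forall>z. E z (vs ! x) \<longrightarrow> E z (vs ! y))"
  by (simp add: is_subset_def nth_append)

lemma holds_is_empty:
  "x < length vs \<Longrightarrow> holds E Q v vs (is_empty x) \<longleftrightarrow> (\<forall>z. \<not> E z (vs ! x))"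
  by (simp add: is_empty_def nth_append)

lemma holds_is_upair:
  "p < length vs \<Longrightarrow> x < length vs \<Longrightarrow> y < length vs \<Longrightarrow>
    holds E Q v vs (is_upair p x y) \<longleftrightarrow> (\<forall>z. E z (vs ! p) \<longleftrightarrow> Q z (vs ! x) \<or> Q z (vs ! y))"
  by (simp add: is_upair_def nth_append)

text \<open>A set containing everything contains itself, contradicting foundation.\<close>

lemma ZF_model_infinite:
  assumes cong: "congruence E Q" and ZF: "\<forall>p\<in>ZF. sat E Q v p"
  shows "infinite (UNIV // {(x, y). Q x y})"
proof
  have "equivp Q" using cong by (simp add: congruence_def)
  then have refl: "Q x x" and sym: "Q x y \<Longrightarrow> Q y x" for x y
    by (simp add: equivp_reflp, rule equivp_symp)
  have E: "E a' b'" if "E a b" "Q a a'" "Q b b'" for a b a' b'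
    using cong that unfolding congruence_def by blast
  have pairing: "\<exists>p. \<forall>z. E z p \<longleftrightarrow> Q z x \<or> Q z y" for x y
  proof -
    have "sat E Q v pairing" using ZF by (simp add: ZF_def)
    then show ?thesis by (simp add: pairing_def sat_closed holds_is_upair)
  qed
  have union: "\<exists>u. \<forall>x. E x u \<longleftrightarrow> (\<exists>y. E y a \<and> E x y)" for a
  proof -
    have "sat E Q v union" using ZF by (simp add: ZF_def)
    then show ?thesis by (simp add: union_def sat_closed)
  qed
  have foundation: "\<exists>y. E y x \<and> \<not> (\<exists>z. E z x \<and> E z y)" if "E z x" for z x
  proof -
    have "sat E Q v foundation" using ZF by (simp add: ZF_def)
    then show ?thesis using that by (auto simp: foundation_def sat_closed holds_is_empty)
  qed
  assume fin: "finite (UNIV // {(x, y). Q x y})"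
  \<comment> \<open>Pairing and union adjoin one class at a time, so finitely many classes fit into
    one set.\<close>
  have "\<exists>u. \<forall>x. x \<in> \<Union>F \<longrightarrow> E x u" if "F \<subseteq> UNIV // {(x, y). Q x y}" for F
    using finite_subset[OF that fin] that
  proof (induction rule: finite_induct)
    case (insert C F)
    then obtain u c where u: "\<forall>x. x \<in> \<Union>F \<longrightarrow> E x u" and C: "C = {(x, y). Q x y} `` {c}"
      by (auto elim: quotientE)
    obtain s where s: "\<forall>z. E z s \<longleftrightarrow> Q z c \<or> Q z c" using pairing[of c c] by blast
    obtain p where p: "\<forall>z. E z p \<longleftrightarrow> Q z u \<or> Q z s" using pairing[of u s] by blast
    obtain w where w: "\<forall>x. E x w \<longleftrightarrow> (\<exists>y. E y p \<and> E x y)" using union[of p] by blast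
    have "E x w" if "x \<in> \<Union>(insert C F)" for x
    proof (cases "x \<in> C")
      case True
      then have "E x s" using s sym C by simp
      then show ?thesis using p w refl by blast
    next
      case False
      then have "E x u" using that u by blast
      then show ?thesis using p w refl by blast
    qed
    then show ?case by blast
  qed simp
  then obtain u where u: "\<And>x. x \<in> \<Union>(UNIV // {(x, y). Q x y}) \<Longrightarrow> E x u" by blast
  have "E x u" for x
    by (rule u) (use refl in \<open>auto simp: quotient_def\<close>)
  \<comment> \<open>Now \<open>u\<close> contains everything, itself included, so its singleton
    \<open>s\<close> has no \<in>-minimal element.\<close>
  obtain s where s: "\<forall>z. E z s \<longleftrightarrow> Q z u \<or> Q z u" using pairing[of u u] by blast
  have "E u s" using s refl by blast
  then obtain y where y: "E y s" "\<not> (\<exists>z. E z s \<and> E z y)" using foundation by blast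
  then have "Q u y" using s sym by blast
  then have "E u y" using E[OF \<open>E u u\<close>, of u y] refl by blast
  then show False using y \<open>E u s\<close> by blast
qed

section \<open>Reduction of derivability to countable models with true equality\<close>

text \<open>The schemas have infinitely many instances, but their universal closures are sentences
  and contribute no variables.\<close>

lemma finite_fv_ZF: "finite (\<Union>q\<in>ZF. fv q)"
proof -
  have "i + k \<in> fv p" if "i \<in> fv ((All ^^ k) p)" for i k p
    using that
  proof (induction k arbitrary: i)
    case (Suc k)
    then show ?case using Suc.IH[of "Suc i"] by simp
  qed simp
  then have "fv (univ_closure p) = {}" for p
    unfolding univ_closure_def using fv_less_fv_bound by fastforce
  then show ?thesis
    by (simp add: ZF_def separation_def replacement_def finite_fv)
qed

text \<open>The quotient of a term model by \<open>Q\<close> is countable, and infinite by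
  \<open>ZF_model_infinite\<close>, so its classes can be numbered by all natural numbers.\<close>

theorem ZF_derivable:
  assumes "\<And>E (v :: nat \<Rightarrow> nat). \<forall>q\<in>ZF. sat E (=) v q \<Longrightarrow> sat E (=) v p"
  shows "ZF \<turnstile> p"
proof (rule completeness[OF finite_fv_ZF])
  fix E Q and v :: "nat \<Rightarrow> nat"
  assume cong: "congruence E Q" and ZF: "\<forall>q\<in>ZF. sat E Q v q"
  define R where "R = {(x, y). Q x y}"
  have Q: "equivp Q" using cong by (simp add: congruence_def)
  then have R: "equiv UNIV R" by (simp add: R_def equivp_equiv)
  have inf: "infinite (UNIV // R)" using ZF_model_infinite[OF cong ZF] by (simp add: R_def)
  have cnt: "countable (UNIV // R)" by (simp add: quotient_def)
  define h where "h x = to_nat_on (UNIV // R) (R `` {x})" for x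
  define E' where "E' a b \<longleftrightarrow> (\<exists>i j. h i = a \<and> h j = b \<and> E i j)" for a b
  \<comment> \<open>Infinitude of the quotient matters here: only then does \<open>to_nat_on\<close>
    reach every number.\<close>
  have "surj h"
  proof (rule surjI)
    fix n
    have "from_nat_into (UNIV // R) n \<in> UNIV // R"
      using inf by (intro from_nat_into) auto
    then have "\<exists>x. from_nat_into (UNIV // R) n = R `` {x}"
      unfolding quotient_def by blast
    from someI_ex[OF this, symmetric]
    have "R `` {SOME x. from_nat_into (UNIV // R) n = R `` {x}} = from_nat_into (UNIV // R) n" .
    then show "h (SOME x. from_nat_into (UNIV // R) n = R `` {x}) = n"
      using cnt inf by (simp add: h_def)
  qed
  moreover have hQ: "Q i j \<longleftrightarrow> h i = h j" for i j
  proof -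
    have "h i = h j \<longleftrightarrow> R `` {i} = R `` {j}"
      using cnt by (simp add: h_def quotientI)
    then show ?thesis using eq_equiv_class_iff[OF R] by (simp add: R_def)
  qed
  moreover have "E i j \<longleftrightarrow> E' (h i) (h j)" for i j
    using cong equivp_reflp[OF Q]
    unfolding E'_def hQ[symmetric] congruence_def by blast
  ultimately have transfer: "sat E Q v q \<longleftrightarrow> sat E' (=) (\<lambda>i. h (v i)) q" for q
    by (rule sat_surj)
  then show "sat E Q v p" using assms ZF by blast
qed

section \<open>Working inside a model of ZF\<close>

locale zf_model =
  fixes E :: "'a \<Rightarrow> 'a \<Rightarrow> bool" and v :: "nat \<Rightarrow> 'a"
  assumes ZF: "\<forall>q\<in>ZF. sat E (=) v q"
begin

abbreviation hold :: "'a list \<Rightarrow> pfm \<Rightarrow> bool" where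
  "hold \<equiv> holds E (=) v"

definition El :: "'a \<Rightarrow> 'a set" where
  "El b = {x. E x b}"

lemma E_iff [simp]: "E x b \<longleftrightarrow> x \<in> El b"
  by (simp add: El_def)

lemma El_inject [simp]: "El x = El y \<longleftrightarrow> x = y"
proof -
  have "sat E (=) v extensionality" using ZF by (simp add: ZF_def)
  then show ?thesis by (auto simp: extensionality_def sat_closed)
qed

text \<open>HOL sets over the domain play the part of classes; the small ones are represented by an
  element of the model.\<close>

definition small :: "'a set \<Rightarrow> bool" where
  "small S \<longleftrightarrow> S \<in> range El"

text \<open>By extensionality a small set has only one representative, so \<open>inv\<close> makes
  no genuine choice there.\<close>

definition mk :: "'a set \<Rightarrow> 'a" where
  "mk S = inv El S"

lemma El_mk [simp]: "small S \<Longrightarrow> El (mk S) = S"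
  by (simp add: small_def mk_def f_inv_into_f)

lemma small_El [simp]: "small (El x)"
  by (simp add: small_def)

lemma eq_mk_iff: "small S \<Longrightarrow> x = mk S \<longleftrightarrow> El x = S"
  by (metis El_inject El_mk)

lemma foundation: "x \<in> El a \<Longrightarrow> \<exists>y\<in>El a. El y \<inter> El a = {}"
proof -
  assume "x \<in> El a"
  have "sat E (=) v foundation" using ZF by (simp add: ZF_def)
  then have "\<forall>a. El a \<noteq> {} \<longrightarrow> (\<exists>y\<in>El a. El y \<inter> El a = {})"
    by (simp add: foundation_def sat_closed holds_is_empty) blast
  then show ?thesis using \<open>x \<in> El a\<close> by blast
qed

lemma small_pair [simp]: "small {x, y}"
proof -
  have "sat E (=) v pairing" using ZF by (simp add: ZF_def)
  then have "\<exists>p. El p = {x, y}"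
    by (simp add: pairing_def sat_closed holds_is_upair set_eq_iff)
  then show ?thesis by (auto simp: small_def)
qed

lemma small_singleton [simp]: "small {x}"
  using small_pair[of x x] by simp

lemma small_Union: "small (\<Union>y\<in>El a. El y)"
proof -
  have "sat E (=) v union" using ZF by (simp add: ZF_def)
  then have "\<forall>a. \<exists>u. El u = (\<Union>y\<in>El a. El y)"
    by (simp add: union_def sat_closed set_eq_iff Bex_def)
  then show ?thesis unfolding small_def by (metis rangeI)
qed

lemma small_Un [simp]:
  assumes "small A" "small B"
  shows "small (A \<union> B)"
  using small_Union[of "mk {mk A, mk B}"] assms by simp

lemma small_insert [simp]: "small A \<Longrightarrow> small (insert x A)"
  using small_Un[of "{x}" A] by simp

lemma small_Pow: "small {x. El x \<subseteq> El a}"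
proof -
  have "sat E (=) v power_set" using ZF by (simp add: ZF_def)
  then have "\<forall>a. \<exists>b. El b = {x. El x \<subseteq> El a}"
    by (simp add: power_set_def sat_closed set_eq_iff subset_iff)
  then show ?thesis unfolding small_def by (metis rangeI)
qed

section \<open>Definable predicates and separation\<close>

text \<open>Separation covers only first-order predicates with parameters, here listed in
  \<open>w\<close>; an arbitrary HOL predicate might smuggle in choice.\<close>

definition definable :: "('a \<Rightarrow> bool) \<Rightarrow> bool" where
  "definable R \<longleftrightarrow> (\<exists>p w. \<forall>x. R x \<longleftrightarrow> sat E (=) (case_nat x w) p)"

text \<open>The parameters in \<open>ps\<close> occupy levels 0, 1, and so on; the element being
  tested has level \<open>length ps\<close>. This explains the numerals in the formulas
  below.\<close>

lemma definableI:
  assumes "\<And>x. R x \<longleftrightarrow> holds E (=) w (ps @ [x]) P"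
  shows "definable R"
  unfolding definable_def
  by (intro exI[of _ "P (Suc (length ps))"] exI[of _ "env w ps"])
    (simp add: assms holds_def case_nat_env)

lemma small_separation:
  assumes "definable R"
  shows "small {x \<in> El a. R x}"
proof -
  obtain p w where R: "\<And>x. R x \<longleftrightarrow> sat E (=) (case_nat x w) p"
    using assms by (auto simp: definable_def)
  \<comment> \<open>The schema reserves index 1 for the set being separated, so the parameters of
    \<open>p\<close> move up past it.\<close>
  let ?p = "ren (case_nat 0 (\<lambda>i. Suc (Suc i))) p"
  have "sat E (=) v (separation ?p)" using ZF by (simp add: ZF_def)
  then have "holds E (=) w [] (\<^bold>\<forall>a. \<^bold>\<exists>b. \<^bold>\<forall>x. x \<^bold>\<in> b \<^bold>\<longleftrightarrow> (x \<^bold>\<in> a \<^bold>\<and> inst ?p [x, a]))"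
    unfolding separation_def sat_closed[symmetric] by (rule sat_univ_closure)
  moreover have "holds E (=) w [a, b, x] (inst ?p [Suc (Suc 0), 0]) \<longleftrightarrow> R x" for a b x
    by (simp add: holds_inst sat_ren R) (rule sat_cong, simp split: nat.split)
  ultimately have "\<exists>b. El b = {x \<in> El a. R x}"
    by (simp add: set_eq_iff)
  then show ?thesis by (auto simp: small_def)
qed

definition zero :: 'a where
  "zero = mk {}"

lemma small_empty [simp]: "small {}"
proof -
  have "definable (\<lambda>_. False)" by (rule definableI[of _ v "[]" "\<lambda>_. Fls"]) (simp add: holds_def)
  from small_separation[OF this] show ?thesis by simp
qed

lemma El_zero [simp]: "El zero = {}"
  by (simp add: zero_def)

lemma El_eq_empty [simp]: "El x = {} \<longleftrightarrow> x = zero"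
  by (metis El_zero El_inject)

lemma hold_is_empty [simp]:
  "x < length vs \<Longrightarrow> holds E (=) w vs (is_empty x) \<longleftrightarrow> vs ! x = zero"
  by (auto simp: holds_is_empty simp flip: El_eq_empty)

definition suc :: "'a \<Rightarrow> 'a" where
  "suc x = mk (insert x (El x))"

lemma El_suc [simp]: "El (suc x) = insert x (El x)"
  by (simp add: suc_def)

lemma hold_is_succ [simp]:
  "s < length vs \<Longrightarrow> x < length vs \<Longrightarrow> holds E (=) w vs (is_succ s x) \<longleftrightarrow> vs ! s = suc (vs ! x)"
  by (auto simp: is_succ_def nth_append suc_def eq_mk_iff)

definition up :: "'a \<Rightarrow> 'a \<Rightarrow> 'a" where
  "up x y = mk {x, y}"

lemma El_up [simp]: "El (up x y) = {x, y}"
  by (simp add: up_def)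

lemma up_commute: "up x y = up y x"
  by (simp add: up_def insert_commute)

lemma hold_is_upair [simp]:
  "p < length vs \<Longrightarrow> x < length vs \<Longrightarrow> y < length vs \<Longrightarrow>
    holds E (=) w vs (is_upair p x y) \<longleftrightarrow> vs ! p = up (vs ! x) (vs ! y)"
  by (auto simp: holds_is_upair up_def eq_mk_iff)

definition op :: "'a \<Rightarrow> 'a \<Rightarrow> 'a" where
  "op x y = up (up x x) (up x y)"

lemma up_eq_iff: "up x y = up x' y' \<longleftrightarrow> x = x' \<and> y = y' \<or> x = y' \<and> y = x'"
  by (metis El_up El_inject doubleton_eq_iff)

lemma op_inject [simp]: "op x y = op x' y' \<longleftrightarrow> x = x' \<and> y = y'"
  by (auto simp: op_def up_eq_iff)

text \<open>Kuratowski pairs over \<open>U\<close> lie in the double power set of \<open>U\<close>.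
  This bounding set is what relations and functions are later separated from.\<close>

lemma small_products: "\<exists>X. \<forall>x\<in>El U. \<forall>y\<in>El U. op x y \<in> El X"
proof -
  obtain P PP where "El P = {x. El x \<subseteq> El U}" "El PP = {x. El x \<subseteq> El P}"
    using El_mk[OF small_Pow] by blast
  then show ?thesis by (intro exI[of _ PP]) (simp add: op_def)
qed

lemma hold_is_opair [simp]:
  "p < length vs \<Longrightarrow> x < length vs \<Longrightarrow> y < length vs \<Longrightarrow>
    holds E (=) w vs (is_opair p x y) \<longleftrightarrow> vs ! p = op (vs ! x) (vs ! y)"
  by (simp add: is_opair_def nth_append op_def)

lemma hold_upair_in [simp]:
  "x < length vs \<Longrightarrow> y < length vs \<Longrightarrow> A < length vs \<Longrightarrow>
    holds E (=) w vs (upair_in x y A) \<longleftrightarrow> up (vs ! x) (vs ! y) \<in> El (vs ! A)"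
  by (simp add: upair_in_def nth_append)

lemma hold_opair_in [simp]:
  "x < length vs \<Longrightarrow> y < length vs \<Longrightarrow> A < length vs \<Longrightarrow>
    holds E (=) w vs (opair_in x y A) \<longleftrightarrow> op (vs ! x) (vs ! y) \<in> El (vs ! A)"
  by (simp add: opair_in_def nth_append)

lemma hold_has_two_elements [simp]:
  "A < length vs \<Longrightarrow> holds E (=) w vs (has_two_elements A) \<longleftrightarrow> (\<exists>x y. x \<noteq> y \<and> vs ! A = up x y)"
  by (simp add: has_two_elements_def nth_append)

definition fun_on :: "'a \<Rightarrow> 'a \<Rightarrow> bool" where
  "fun_on f X \<longleftrightarrow> (\<forall>p\<in>El f. \<exists>x\<in>El X. \<exists>y. p = op x y) \<and> (\<forall>x\<in>El X. \<exists>y. op x y \<in> El f) \<and>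
     (\<forall>x y z. op x y \<in> El f \<and> op x z \<in> El f \<longrightarrow> y = z)"

lemma hold_is_fun_on [simp]:
  "f < length vs \<Longrightarrow> X < length vs \<Longrightarrow> holds E (=) w vs (is_fun_on f X) \<longleftrightarrow> fun_on (vs ! f) (vs ! X)"
  by (simp add: is_fun_on_def nth_append fun_on_def Ball_def Bex_def)

definition bij :: "'a \<Rightarrow> 'a \<Rightarrow> 'a \<Rightarrow> bool" where
  "bij f X Y \<longleftrightarrow> fun_on f X \<and> (\<forall>x y. op x y \<in> El f \<longrightarrow> y \<in> El Y) \<and>
     (\<forall>x x' y. op x y \<in> El f \<and> op x' y \<in> El f \<longrightarrow> x = x') \<and> (\<forall>y\<in>El Y. \<exists>x. op x y \<in> El f)"

lemma hold_is_fun [simp]: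
  "f < length vs \<Longrightarrow> X < length vs \<Longrightarrow> Y < length vs \<Longrightarrow> holds E (=) w vs (is_fun f X Y) \<longleftrightarrow>
    fun_on (vs ! f) (vs ! X) \<and> (\<forall>x y. op x y \<in> El (vs ! f) \<longrightarrow> y \<in> El (vs ! Y))"
  by (simp add: is_fun_def nth_append)

lemma hold_is_bij [simp]:
  "f < length vs \<Longrightarrow> X < length vs \<Longrightarrow> Y < length vs \<Longrightarrow>
    holds E (=) w vs (is_bij f X Y) \<longleftrightarrow> bij (vs ! f) (vs ! X) (vs ! Y)"
  by (simp add: is_bij_def nth_append bij_def Ball_def)

definition natural :: "'a \<Rightarrow> bool" where
  "natural n \<longleftrightarrow> (\<forall>I. zero \<in> El I \<and> (\<forall>x\<in>El I. suc x \<in> El I) \<longrightarrow> n \<in> El I)"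

lemma hold_is_inductive [simp]:
  "I < length vs \<Longrightarrow> holds E (=) w vs (is_inductive I) \<longleftrightarrow>
    zero \<in> El (vs ! I) \<and> (\<forall>x\<in>El (vs ! I). suc x \<in> El (vs ! I))"
  by (simp add: is_inductive_def nth_append Ball_def)

lemma hold_is_nat [simp]:
  "n < length vs \<Longrightarrow> holds E (=) w vs (is_nat n) \<longleftrightarrow> natural (vs ! n)"
  by (simp add: is_nat_def nth_append natural_def)

definition fin :: "'a \<Rightarrow> bool" where
  "fin X \<longleftrightarrow> (\<exists>n f. natural n \<and> bij f n X)"

lemma hold_is_finite [simp]:
  "X < length vs \<Longrightarrow> holds E (=) w vs (is_finite X) \<longleftrightarrow> fin (vs ! X)"
  by (simp add: is_finite_def nth_append fin_def)

section \<open>Induction on natural numbers and on finite sets of the model\<close>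

lemma natural_zero: "natural zero"
  by (simp add: natural_def)

lemma natural_suc: "natural n \<Longrightarrow> natural (suc n)"
  by (auto simp: natural_def)

text \<open>Separating \<open>R\<close> from an inductive set leaves an inductive set. Definability
  is essential, as the natural numbers of the model may be nonstandard.\<close>

lemma natural_induct:
  assumes "definable R" "natural n" "R zero" "\<And>n. R n \<Longrightarrow> R (suc n)"
  shows "R n"
proof -
  have "sat E (=) v infinity" using ZF by (simp add: ZF_def)
  then obtain I where I: "zero \<in> El I" "\<forall>x\<in>El I. suc x \<in> El I"
    by (auto simp: infinity_def sat_closed)
  have small: "small {x \<in> El I. R x}" using assms(1) by (rule small_separation)
  have "n \<in> El J" if "zero \<in> El J" "\<forall>x\<in>El J. suc x \<in> El J" for J
    using \<open>natural n\<close> that unfolding natural_def by blast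
  from this[of "mk {x \<in> El I. R x}"] show ?thesis
    using small assms(3,4) I by simp
qed

lemma not_mem_self: "x \<notin> El x"
  using foundation[of x "mk {x}"] by auto

lemma fin_zero: "fin zero"
  unfolding fin_def bij_def fun_on_def
  by (intro exI[of _ zero]) (simp add: natural_zero)

text \<open>A bijection from \<open>n\<close> is extended by the pair of \<open>n\<close> and
  \<open>x\<close>; it stays a function because \<open>n\<close> is not an element of
  itself.\<close>

lemma fin_insert:
  assumes "fin X" "El Y = insert x (El X)"
  shows "fin Y"
proof (cases "x \<in> El X")
  case True
  then have "Y = X" using assms(2) by (simp add: insert_absorb)
  then show ?thesis using assms(1) by simp
next
  case False
  obtain n f where n: "natural n" and f: "bij f n X" using assms(1) by (auto simp: fin_def)
  define g where "g = mk (insert (op n x) (El f))"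
  have g: "El g = insert (op n x) (El f)" by (simp add: g_def)
  have dom: "a \<in> El n" and ran: "b \<in> El X" if "op a b \<in> El f" for a b
  proof -
    have "\<exists>a'\<in>El n. \<exists>b'. op a b = op a' b'" using f that unfolding bij_def fun_on_def by blast
    then show "a \<in> El n" by auto
    show "b \<in> El X" using f that unfolding bij_def by blast
  qed
  have "\<forall>p\<in>El f. \<exists>a\<in>El n. \<exists>b. p = op a b" "\<forall>a\<in>El n. \<exists>b. op a b \<in> El f"
    "\<forall>b\<in>El X. \<exists>a. op a b \<in> El f"
    and fn: "\<And>a b c. op a b \<in> El f \<Longrightarrow> op a c \<in> El f \<Longrightarrow> b = c"
    "\<And>a b c. op a c \<in> El f \<Longrightarrow> op b c \<in> El f \<Longrightarrow> a = b"
    using f unfolding bij_def fun_on_def by blast+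
  then have "\<forall>p\<in>El g. \<exists>a\<in>El (suc n). \<exists>b. p = op a b" "\<forall>a\<in>El (suc n). \<exists>b. op a b \<in> El g"
    "\<forall>b\<in>El Y. \<exists>a. op a b \<in> El g"
    unfolding g assms(2) El_suc by blast+
  moreover have g_mem: "op a b \<in> El g \<longleftrightarrow> a = n \<and> b = x \<or> op a b \<in> El f" for a b
    by (simp add: g)
  moreover have "\<forall>a b c. op a b \<in> El g \<and> op a c \<in> El g \<longrightarrow> b = c"
    "\<forall>a b c. op a c \<in> El g \<and> op b c \<in> El g \<longrightarrow> a = b"
    unfolding g_mem using dom ran False fn not_mem_self[of n] by blast+
  moreover have "\<forall>a b. op a b \<in> El g \<longrightarrow> b \<in> El Y"
    unfolding g_mem assms(2) using ran by blast
  ultimately have "bij g (suc n) Y" unfolding bij_def fun_on_def by blast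
  then show ?thesis using natural_suc[OF n] unfolding fin_def by blast
qed

lemma small_remove [simp]: "small (El a - {c})"
proof -
  have "definable (\<lambda>z. z \<noteq> c)"
    by (rule definableI[of _ v "[c]" "\<^bold>\<not> (1 \<^bold>= 0)"]) simp
  from small_separation[OF this, of a] show ?thesis by (simp add: set_diff_eq)
qed

text \<open>Reduces to induction on the cardinality \<open>n\<close>, applied to the definable
  statement that all sets in bijection with \<open>n\<close> satisfy \<open>R\<close>.\<close>

lemma fin_induct:
  assumes "definable R" "fin X" "R zero" "\<And>X x Y. R X \<Longrightarrow> El Y = insert x (El X) \<Longrightarrow> R Y"
  shows "R X"
proof -
  obtain p w where R: "\<And>x. R x \<longleftrightarrow> sat E (=) (case_nat x w) p"
    using assms(1) by (auto simp: definable_def)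
  have inst: "holds E (=) w [n, X, f] (inst p [Suc 0]) \<longleftrightarrow> R X" for n X f
    by (simp add: holds_inst R) (rule sat_cong, simp split: nat.split)
  define S where "S n \<longleftrightarrow> (\<forall>X f. bij f n X \<longrightarrow> R X)" for n
  have "definable S"
    by (rule definableI[of _ w "[]" "\<^bold>\<forall>X. \<^bold>\<forall>f. is_bij f 0 X \<^bold>\<longrightarrow> inst p [X]"])
      (simp add: S_def inst)
  moreover obtain n f where "natural n" and f: "bij f n X"
    using \<open>fin X\<close> by (auto simp: fin_def)
  moreover have "S zero"
  proof -
    have "X = zero" if "bij f zero X" for f X
    proof -
      have "\<not> op a b \<in> El f" for a b using that unfolding bij_def fun_on_def by force
      then have "El X = {}" using that unfolding bij_def by blast
      then show ?thesis by simp
    qed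
    then show ?thesis using assms(3) unfolding S_def by blast
  qed
  moreover have "S (suc n)" if "S n" for n
    unfolding S_def
  proof (intro allI impI)
    fix X f
    assume f: "bij f (suc n) X"
    then obtain y where y: "op n y \<in> El f" "y \<in> El X"
      unfolding bij_def fun_on_def by (auto simp: Ball_def)
    \<comment> \<open>The element matched with the last number \<open>n\<close> is taken away, which
      leaves a bijection from \<open>n\<close> onto the rest.\<close>
    define Y g where "Y = mk (El X - {y})" and "g = mk (El f - {op n y})"
    have Y: "El Y = El X - {y}" by (simp add: Y_def)
    have g: "El g = El f - {op n y}" by (simp add: g_def)
    have g_mem: "op a b \<in> El g \<longleftrightarrow> op a b \<in> El f \<and> \<not> (a = n \<and> b = y)" for a b
      by (simp add: g)
    have *: "\<And>p. p \<in> El f \<Longrightarrow> \<exists>a\<in>El (suc n). \<exists>b. p = op a b"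
      "\<And>a. a \<in> El (suc n) \<Longrightarrow> \<exists>b. op a b \<in> El f" "\<And>b. b \<in> El X \<Longrightarrow> \<exists>a. op a b \<in> El f"
      "\<And>a b c. op a b \<in> El f \<Longrightarrow> op a c \<in> El f \<Longrightarrow> b = c"
      "\<And>a b c. op a c \<in> El f \<Longrightarrow> op b c \<in> El f \<Longrightarrow> a = b"
      "\<And>a b. op a b \<in> El f \<Longrightarrow> b \<in> El X"
      using f unfolding bij_def fun_on_def by blast+
    have "\<forall>p\<in>El g. \<exists>a\<in>El n. \<exists>b. p = op a b"
    proof
      fix p
      assume p: "p \<in> El g"
      then obtain a b where ab: "a \<in> El (suc n)" "p = op a b" using *(1) g by blast
      then have "a \<noteq> n" using p g_mem *(4) y(1) by blast
      then show "\<exists>a\<in>El n. \<exists>b. p = op a b" using ab by auto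
    qed
    moreover have "\<forall>a\<in>El n. \<exists>b. op a b \<in> El g"
      using *(2) not_mem_self[of n] unfolding g_mem El_suc by blast
    moreover have "\<forall>b\<in>El Y. \<exists>a. op a b \<in> El g"
      using *(3) unfolding g_mem Y by blast
    moreover have "\<forall>a b c. op a b \<in> El g \<and> op a c \<in> El g \<longrightarrow> b = c"
      using *(4) unfolding g_mem by blast
    moreover have "\<forall>a b c. op a c \<in> El g \<and> op b c \<in> El g \<longrightarrow> a = b"
      using *(5) unfolding g_mem by blast
    moreover have "\<forall>a b. op a b \<in> El g \<longrightarrow> b \<in> El Y"
      using *(5,6) y(1) unfolding g_mem Y by blast
    ultimately have "bij g n Y" unfolding bij_def fun_on_def by blast
    then have "R Y" using that S_def by blast
    then show "R X" by (rule assms(4)[of Y X y]) (use Y y in auto)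
  qed
  ultimately have "S n" using natural_induct[of S n] by blast
  then show ?thesis using f S_def by blast
qed

lemma fin_Un:
  assumes "fin A" "fin B"
  shows "fin (mk (El A \<union> El B))"
proof -
  \<comment> \<open>The union is described by an existential formula because \<open>mk\<close> is
    not part of the formal language.\<close>
  have "\<exists>U. El U = El A \<union> El B \<and> fin U"
  proof (rule fin_induct[of "\<lambda>B. \<exists>U. El U = El A \<union> El B \<and> fin U"])
    show "definable (\<lambda>B. \<exists>U. El U = El A \<union> El B \<and> fin U)"
      by (rule definableI[of _ v "[A]" "\<^bold>\<exists>U. (\<^bold>\<forall>z. z \<^bold>\<in> U \<^bold>\<longleftrightarrow> z \<^bold>\<in> 0 \<^bold>\<or> z \<^bold>\<in> 1) \<^bold>\<and> is_finite U"])
        (simp add: set_eq_iff)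
    fix X x Y
    assume "\<exists>U. El U = El A \<union> El X \<and> fin U" and Y: "El Y = insert x (El X)"
    then obtain U where U: "El U = El A \<union> El X" "fin U" by blast
    have "El (mk (insert x (El U))) = insert x (El U)" by simp
    with fin_insert[OF U(2) this] show "\<exists>U. El U = El A \<union> El Y \<and> fin U"
      by (intro exI[of _ "mk (insert x (El U))"]) (simp add: U Y)
  qed (use assms in auto)
  then obtain U where U: "El U = El A \<union> El B" "fin U" by blast
  then have "U = mk (El A \<union> El B)" by (simp add: eq_mk_iff)
  then show ?thesis using U(2) by simp
qed

lemma fin_up: "fin (up x y)"
proof -
  have "fin (up y y)" by (rule fin_insert[OF fin_zero]) simp
  then show ?thesis by (rule fin_insert) simp
qed

lemma fun_on_ex: "fun_on f X \<Longrightarrow> x \<in> El X \<Longrightarrow> \<exists>y. op x y \<in> El f"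
  by (simp add: fun_on_def)

lemma fun_on_unique: "fun_on f X \<Longrightarrow> op x y \<in> El f \<Longrightarrow> op x z \<in> El f \<Longrightarrow> y = z"
  by (auto simp: fun_on_def)

section \<open>Graphs in a model of ZF\<close>

definition loop_graph :: "'a \<Rightarrow> 'a \<Rightarrow> bool" where
  "loop_graph V G \<longleftrightarrow> (\<forall>e\<in>El G. \<exists>x\<in>El V. \<exists>y\<in>El V. e = up x y)"

definition graph :: "'a \<Rightarrow> 'a \<Rightarrow> bool" where
  "graph V G \<longleftrightarrow> loop_graph V G \<and> (\<forall>x. up x x \<notin> El G)"

definition hom :: "'a \<Rightarrow> 'a \<Rightarrow> 'a \<Rightarrow> 'a \<Rightarrow> 'a \<Rightarrow> bool" where
  "hom f V G V' G' \<longleftrightarrow> fun_on f V \<and> (\<forall>x y. op x y \<in> El f \<longrightarrow> y \<in> El V') \<and>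
     (\<forall>x y x' y'. up x y \<in> El G \<and> op x x' \<in> El f \<and> op y y' \<in> El f \<longrightarrow> up x' y' \<in> El G')"

lemma hold_is_loop_graph [simp]:
  "V < length vs \<Longrightarrow> G < length vs \<Longrightarrow>
    holds E (=) w vs (is_loop_graph V G) \<longleftrightarrow> loop_graph (vs ! V) (vs ! G)"
  by (simp add: is_loop_graph_def nth_append loop_graph_def Ball_def Bex_def)

lemma hold_is_graph [simp]:
  "V < length vs \<Longrightarrow> G < length vs \<Longrightarrow>
    holds E (=) w vs (is_graph V G) \<longleftrightarrow> graph (vs ! V) (vs ! G)"
  by (simp add: is_graph_def nth_append graph_def)

lemma hold_is_hom [simp]:
  "f < length vs \<Longrightarrow> V < length vs \<Longrightarrow> G < length vs \<Longrightarrow> V' < length vs \<Longrightarrow> G' < length vs \<Longrightarrow>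
    holds E (=) w vs (is_hom f V G V' G') \<longleftrightarrow> hom (vs ! f) (vs ! V) (vs ! G) (vs ! V') (vs ! G')"
  by (simp add: is_hom_def nth_append hom_def)

lemma hold_P_G_H2:
  "hold [] P_G_H2 \<longleftrightarrow> (\<forall>V G V' G'. graph V G \<and> \<not> fin V \<and> loop_graph V' G' \<and> fin V' \<and>
     (\<exists>a b. a \<noteq> b \<and> V' = up a b) \<and>
     (\<forall>W F. graph W F \<and> El W \<subseteq> El V \<and> El F \<subseteq> El G \<and> fin W \<longrightarrow> (\<exists>f. hom f W F V' G')) \<longrightarrow>
     (\<exists>f. hom f V G V' G'))"
  by (simp add: P_G_H2_def is_subgraph_def subset_iff)

lemma hold_AC2:
  "hold [] AC2 \<longleftrightarrow> (\<forall>A. (\<forall>p\<in>El A. \<exists>x y. x \<noteq> y \<and> p = up x y) \<longrightarrow>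
     (\<exists>f. fun_on f A \<and> (\<forall>p x. op p x \<in> El f \<longrightarrow> x \<in> El p)))"
  by (simp add: AC2_def Ball_def)

text \<open>A set \<open>C\<close> stands for the 2-colouring of \<open>W\<close> with colour classes \<open>W \<inter> C\<close> and \<open>W - C\<close>;
  the edges of \<open>G\<close> not contained in \<open>W\<close> are ignored.\<close>

definition colouring :: "'a \<Rightarrow> 'a \<Rightarrow> 'a \<Rightarrow> bool" where
  "colouring G W C \<longleftrightarrow> (\<forall>x\<in>El W. \<forall>y\<in>El W. up x y \<in> El G \<longrightarrow> (x \<in> El C \<longleftrightarrow> y \<notin> El C))"

definition is_colouring :: "lvl \<Rightarrow> lvl \<Rightarrow> lvl \<Rightarrow> pfm" where
  "is_colouring G W C = (\<^bold>\<forall>x. \<^bold>\<forall>y. x \<^bold>\<in> W \<^bold>\<and> y \<^bold>\<in> W \<^bold>\<and> upair_in x y G \<^bold>\<longrightarrow> (x \<^bold>\<in> C \<^bold>\<longleftrightarrow> \<^bold>\<not> y \<^bold>\<in> C))"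

lemma hold_is_colouring [simp]:
  "G < length vs \<Longrightarrow> W < length vs \<Longrightarrow> C < length vs \<Longrightarrow>
    holds E (=) w vs (is_colouring G W C) \<longleftrightarrow> colouring (vs ! G) (vs ! W) (vs ! C)"
  by (simp add: is_colouring_def nth_append colouring_def Ball_def) blast

lemma colouring_mono:
  "colouring G W C \<Longrightarrow> El W' \<subseteq> El W \<Longrightarrow> El G' \<subseteq> El G \<Longrightarrow> colouring G' W' C"
  unfolding colouring_def by blast

text \<open>The function is separated from a set of pairs; the case distinction is written as a
  disjunction so that a formula can express it.\<close>

lemma ex_two_valued_fun:
  obtains f where "fun_on f V"
    "\<And>x y. op x y \<in> El f \<longleftrightarrow> x \<in> El V \<and> y = (if x \<in> El C then a else b)"
proof -
  obtain X where X: "\<forall>x\<in>El V \<union> {a, b}. \<forall>y\<in>El V \<union> {a, b}. op x y \<in> El X"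
    using small_products[of "mk (El V \<union> {a, b})"] by auto
  let ?R = "\<lambda>z. \<exists>x. x \<in> El V \<and> (x \<in> El C \<and> z = op x a \<or> x \<notin> El C \<and> z = op x b)"
  have "definable ?R"
    by (rule definableI[of _ v "[V, C, a, b]" "\<^bold>\<exists>x. x \<^bold>\<in> 0 \<^bold>\<and>
        ((x \<^bold>\<in> 1 \<^bold>\<and> is_opair 4 x 2) \<^bold>\<or> (\<^bold>\<not> (x \<^bold>\<in> 1) \<^bold>\<and> is_opair 4 x 3))"]) simp
  then have "small {z \<in> El X. ?R z}" by (rule small_separation)
  then obtain f where f: "El f = {z \<in> El X. ?R z}" using El_mk by blast
  have f_mem: "op x y \<in> El f \<longleftrightarrow> x \<in> El V \<and> y = (if x \<in> El C then a else b)" for x y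
    unfolding f using X by auto
  have "\<forall>p\<in>El f. \<exists>x\<in>El V. \<exists>y. p = op x y" unfolding f by blast
  then have "fun_on f V" unfolding fun_on_def f_mem by simp
  then show thesis using f_mem by (rule that)
qed

lemma colouring_imp_hom:
  assumes "colouring G V C" "a \<in> El V'" "b \<in> El V'" "up a b \<in> El G'"
  obtains f where "hom f V G V' G'"
proof -
  obtain f where f: "fun_on f V" "\<And>x y. op x y \<in> El f \<longleftrightarrow> x \<in> El V \<and> y = (if x \<in> El C then a else b)"
    by (rule ex_two_valued_fun[of V C a b]) blast
  have "hom f V G V' G'"
    unfolding hom_def
  proof (intro conjI allI impI)
    fix x y x' y'
    assume *: "up x y \<in> El G \<and> op x x' \<in> El f \<and> op y y' \<in> El f"
    then have "x \<in> El C \<longleftrightarrow> y \<notin> El C" using assms(1) unfolding colouring_def f(2) by blast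
    then have "up x' y' = up a b" using * unfolding f(2) by (auto simp: up_commute)
    then show "up x' y' \<in> El G'" using assms(4) by simp
  qed (use f assms(2,3) in auto)
  then show thesis by (rule that)
qed

lemma const_hom:
  assumes "c \<in> El V'" "up c c \<in> El G' \<or> El G = {}"
  obtains f where "hom f V G V' G'"
proof -
  \<comment> \<open>A constant map is the two-valued map with both values equal to
    \<open>c\<close>.\<close>
  obtain f where f: "fun_on f V" "\<And>x y. op x y \<in> El f \<longleftrightarrow> x \<in> El V \<and> y = (if x \<in> El V then c else c)"
    by (rule ex_two_valued_fun[of V V c c]) blast
  have "hom f V G V' G'"
    using assms f(1) unfolding hom_def f(2) by auto
  then show thesis by (rule that)
qed

text \<open>Without loops at \<open>a\<close> and \<open>b\<close>, adjacent vertices have different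
  images, so the preimage of \<open>a\<close> is a colour class.\<close>

lemma hom_imp_colouring:
  assumes "hom f V G (up a b) G'" "up a a \<notin> El G'" "up b b \<notin> El G'"
  obtains C where "colouring G V C"
proof -
  have "definable (\<lambda>x. op x a \<in> El f)"
    by (rule definableI[of _ v "[a, f]" "opair_in 2 0 1"]) simp
  then have "small {x \<in> El V. op x a \<in> El f}" by (rule small_separation)
  then obtain C where C: "El C = {x \<in> El V. op x a \<in> El f}" using El_mk by blast
  have "x \<in> El C \<longleftrightarrow> y \<notin> El C" if e: "x \<in> El V" "y \<in> El V" "up x y \<in> El G" for x y
  proof -
    have f: "fun_on f V" and ran: "\<And>x y. op x y \<in> El f \<Longrightarrow> y = a \<or> y = b"
      and edge: "\<And>x y x' y'. up x y \<in> El G \<Longrightarrow> op x x' \<in> El f \<Longrightarrow> op y y' \<in> El f \<Longrightarrow> up x' y' \<in> El G'"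
      using assms(1) by (auto simp: hom_def)
    obtain x' y' where xy: "op x x' \<in> El f" "op y y' \<in> El f"
      using fun_on_ex[OF f] e by blast
    have "up x' y' \<in> El G'" using edge[OF e(3) xy] .
    moreover have "x' = a \<or> x' = b" "y' = a \<or> y' = b" using xy ran by blast+
    moreover have "x \<in> El C \<longleftrightarrow> x' = a" "y \<in> El C \<longleftrightarrow> y' = a"
      using e xy fun_on_unique[OF f] unfolding C by blast+
    ultimately show ?thesis using assms(2,3) by auto
  qed
  then show thesis using that unfolding colouring_def by blast
qed

section \<open>Induced subgraphs and colourings of finite vertex sets\<close>

lemma ex_induced_subgraph:
  assumes "graph V G" "El W \<subseteq> El V"
  obtains F where "graph W F" "El F \<subseteq> El G"
    "\<And>x y. x \<in> El W \<Longrightarrow> y \<in> El W \<Longrightarrow> up x y \<in> El F \<longleftrightarrow> up x y \<in> El G"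
proof -
  have "definable (\<lambda>e. El e \<subseteq> El W)"
    by (rule definableI[of _ v "[W]" "is_subset 1 0"]) (simp add: subset_iff)
  then have "small {e \<in> El G. El e \<subseteq> El W}" by (rule small_separation)
  then obtain F where F: "El F = {e \<in> El G. El e \<subseteq> El W}" using El_mk by blast
  have "graph W F"
    using assms(1) unfolding graph_def loop_graph_def F by fastforce
  then show thesis using F by (intro that[of F]) auto
qed

text \<open>Vertices are added one by one. Each has at most one neighbour, so giving it the opposite
  colour causes no conflict.\<close>

lemma ex_edge_colouring:
  assumes "\<And>x. up x x \<notin> El G" "\<And>x y z. up x y \<in> El G \<Longrightarrow> up x z \<in> El G \<Longrightarrow> y = z" "fin W"
  shows "\<exists>C. colouring G W C"
proof (rule fin_induct[of "\<lambda>W. \<exists>C. colouring G W C", OF _ \<open>fin W\<close>])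
  show "definable (\<lambda>W. \<exists>C. colouring G W C)"
    by (rule definableI[of _ v "[G]" "\<^bold>\<exists>C. is_colouring 0 1 C"]) simp
  show "\<exists>C. colouring G zero C" by (simp add: colouring_def)
  fix X x Y
  assume "\<exists>C. colouring G X C" and Y: "El Y = insert x (El X)"
  then obtain C where C: "colouring G X C" by blast
  show "\<exists>C. colouring G Y C"
  proof (cases "x \<in> El X")
    case True
    then have "Y = X" using Y by (simp add: insert_absorb)
    then show ?thesis using C by blast
  next
    case False
    \<comment> \<open>\<open>C\<close> is not confined to \<open>X\<close> and may already contain
      \<open>x\<close>, hence the explicit removal or insertion.\<close>
    define D where "D = mk (if \<exists>n\<in>El C. up x n \<in> El G then El C - {x} else insert x (El C))"
    have D: "El D = (if \<exists>n\<in>El C. up x n \<in> El G then El C - {x} else insert x (El C))"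
      by (simp add: D_def)
    have old: "y \<in> El D \<longleftrightarrow> y \<in> El C" if "y \<in> El X" for y
      using that False by (auto simp: D)
    have new: "x \<in> El D \<longleftrightarrow> y \<notin> El D" if "y \<in> El X" "up x y \<in> El G" for y
    proof -
      \<comment> \<open>A neighbour of \<open>x\<close> in \<open>C\<close> might lie outside
        \<open>X\<close>; uniqueness of neighbours identifies it with \<open>y\<close>.\<close>
      have "(\<exists>n\<in>El C. up x n \<in> El G) \<longleftrightarrow> y \<in> El C" using that assms(2) by blast
      then show ?thesis using old[OF that(1)] D by auto
    qed
    have "colouring G Y D"
      unfolding colouring_def
    proof (intro ballI impI)
      fix y z
      assume yz: "y \<in> El Y" "z \<in> El Y" and e: "up y z \<in> El G"
      show "y \<in> El D \<longleftrightarrow> z \<notin> El D"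
      proof (cases "y = x \<or> z = x")
        case True
        then show ?thesis using new[of y] new[of z] yz e assms(1)[of x] up_commute[of y z] Y by auto
      next
        case False
        then show ?thesis using C old[of y] old[of z] yz e unfolding colouring_def Y by blast
      qed
    qed
    then show ?thesis by blast
  qed
qed

section \<open>From homomorphisms to choice functions\<close>

lemma P_G_H2_imp_AC2:
  assumes "hold [] P_G_H2"
  shows "hold [] AC2"
  unfolding hold_AC2
proof (intro allI impI)
  fix A
  assume A: "\<forall>p\<in>El A. \<exists>x y. x \<noteq> y \<and> p = up x y"
  \<comment> \<open>One bounding set serves both the vertices \<open>op x p\<close> and the pairs
    \<open>op p x\<close> of the choice function.\<close>
  obtain X where X: "\<forall>x\<in>(\<Union>p\<in>El A. El p) \<union> El A. \<forall>y\<in>(\<Union>p\<in>El A. El p) \<union> El A. op x y \<in> El X"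
    using small_products[of "mk ((\<Union>p\<in>El A. El p) \<union> El A)"] by (auto simp: small_Union)
  let ?V = "\<lambda>z. \<exists>p x. p \<in> El A \<and> x \<in> El p \<and> z = op x p"
  have "definable ?V"
    by (rule definableI[of _ v "[A]" "\<^bold>\<exists>p. \<^bold>\<exists>x. p \<^bold>\<in> 0 \<^bold>\<and> x \<^bold>\<in> p \<^bold>\<and> is_opair 1 x p"]) simp
  then have "small {z \<in> El X. ?V z}" by (rule small_separation)
  then obtain V where "El V = {z \<in> El X. ?V z}" using El_mk by blast
  then have V: "El V = {z. ?V z}" using X by auto
  \<comment> \<open>The vertices \<open>q\<close> and \<open>r\<close> are quantified because the
    formal language has no terms for pairs.\<close>
  let ?G = "\<lambda>e. \<exists>p x y q r. p \<in> El A \<and> x \<in> El p \<and> y \<in> El p \<and> x \<noteq> y \<and>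
    q = op x p \<and> r = op y p \<and> e = up q r"
  have "definable ?G"
    by (rule definableI[of _ v "[A]" "\<^bold>\<exists>p. \<^bold>\<exists>x. \<^bold>\<exists>y. \<^bold>\<exists>q. \<^bold>\<exists>r. p \<^bold>\<in> 0 \<^bold>\<and> x \<^bold>\<in> p \<^bold>\<and> y \<^bold>\<in> p \<^bold>\<and> \<^bold>\<not> (x \<^bold>= y) \<^bold>\<and>
      is_opair q x p \<^bold>\<and> is_opair r y p \<^bold>\<and> is_upair 1 q r"]) simp
  moreover obtain PV where PV: "El PV = {x. El x \<subseteq> El V}" using El_mk[OF small_Pow] by blast
  ultimately have "small {e \<in> El PV. ?G e}" by (intro small_separation)
  then obtain G where "El G = {e \<in> El PV. ?G e}" using El_mk by blast
  then have G: "El G = {e. ?G e}" unfolding PV V by auto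
  have edge: "up q r \<in> El G \<longleftrightarrow>
      (\<exists>p x y. p \<in> El A \<and> x \<in> El p \<and> y \<in> El p \<and> x \<noteq> y \<and> q = op x p \<and> r = op y p)" for q r
    unfolding G by (auto simp: up_eq_iff)
  have graph: "graph V G"
    unfolding graph_def loop_graph_def edge unfolding G V by auto
  have two: "y = x \<or> y = x'" if "p \<in> El A" "x \<in> El p" "x' \<in> El p" "x \<noteq> x'" "y \<in> El p" for p x x' y
    using that A by auto
  have "\<exists>C. colouring G W C" if "fin W" for W
  proof (rule ex_edge_colouring[OF _ _ that])
    show "y = z" if "up x y \<in> El G" "up x z \<in> El G" for x y z
      using that two unfolding edge by auto metis
  qed (simp add: edge)
  then have fin: "\<exists>C. colouring G W C" if "fin W" for W using that by blast
  \<comment> \<open>The target is a single edge without loops, so homomorphisms into it amount to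
    2-colourings.\<close>
  define V' G' where "V' = up zero (suc zero)" and "G' = up V' V'"
  have V': "zero \<noteq> suc zero" using not_mem_self[of zero] El_suc[of zero] by (metis insertI1)
  have G': "up zero (suc zero) \<in> El G'" "up zero zero \<notin> El G'" "up (suc zero) (suc zero) \<notin> El G'"
    using V' by (auto simp: G'_def V'_def up_eq_iff)
  have "\<exists>C. colouring G V C"
  proof (cases "fin V")
    case True
    then show ?thesis by (rule fin)
  next
    case False
    have "loop_graph V' G'" by (auto simp: loop_graph_def G'_def V'_def)
    moreover have "\<exists>f. hom f W F V' G'" if "El F \<subseteq> El G" "fin W" for W F
    proof -
      obtain C where "colouring G W C" using fin[OF \<open>fin W\<close>] by blast
      then have "colouring F W C" by (rule colouring_mono) (use that in auto)
      then obtain f where "hom f W F V' G'"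
        by (rule colouring_imp_hom[of F W C zero V' "suc zero" G']) (use G' in \<open>auto simp: V'_def\<close>)
      then show ?thesis by blast
    qed
    moreover have "fin V'" "\<exists>a b. a \<noteq> b \<and> V' = up a b" using fin_up V' unfolding V'_def by blast+
    ultimately have "\<exists>f. hom f V G V' G'"
      using assms[unfolded hold_P_G_H2, rule_format, of V G V' G'] graph False by blast
    then obtain f where "hom f V G V' G'" ..
    then show ?thesis using hom_imp_colouring[of f V G zero "suc zero" G'] G' unfolding V'_def by blast
  qed
  then obtain C where C: "colouring G V C" by blast
  let ?f = "\<lambda>z. \<exists>p x q. p \<in> El A \<and> x \<in> El p \<and> q = op x p \<and> q \<in> El C \<and> z = op p x"
  have "definable ?f"
    by (rule definableI[of _ v "[A, C]" "\<^bold>\<exists>p. \<^bold>\<exists>x. \<^bold>\<exists>q. p \<^bold>\<in> 0 \<^bold>\<and> x \<^bold>\<in> p \<^bold>\<and> is_opair q x p \<^bold>\<and> q \<^bold>\<in> 1 \<^bold>\<and> is_opair 2 p x"]) simp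
  then have "small {z \<in> El X. ?f z}" by (rule small_separation)
  then obtain f where "El f = {z \<in> El X. ?f z}" using El_mk by blast
  then have f: "El f = {z. ?f z}" using X by auto
  have f_mem: "op p x \<in> El f \<longleftrightarrow> p \<in> El A \<and> x \<in> El p \<and> op x p \<in> El C" for p x
    unfolding f by auto
  \<comment> \<open>The two vertices over \<open>p\<close> are adjacent, so exactly one of them lies
    in \<open>C\<close>; this gives existence and uniqueness of the chosen element.\<close>
  have choose: "op x p \<in> El C \<longleftrightarrow> op y p \<notin> El C" if "p \<in> El A" "x \<in> El p" "y \<in> El p" "x \<noteq> y" for p x y
  proof -
    have "up (op x p) (op y p) \<in> El G" using that by (auto simp: edge)
    moreover have "op x p \<in> El V" "op y p \<in> El V" using that unfolding V by auto
    ultimately show ?thesis using C unfolding colouring_def by blast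
  qed
  have "\<exists>x. op p x \<in> El f" if "p \<in> El A" for p
  proof -
    obtain x y where xy: "x \<noteq> y" "p = up x y" using A \<open>p \<in> El A\<close> by blast
    then show ?thesis using choose[of p x y] that unfolding f_mem by auto
  qed
  moreover have "\<forall>z\<in>El f. \<exists>p\<in>El A. \<exists>x. z = op p x" unfolding f by blast
  moreover have "x = y" if "op p x \<in> El f" "op p y \<in> El f" for p x y
    using that choose unfolding f_mem by blast
  ultimately have "fun_on f A" unfolding fun_on_def by blast
  then show "\<exists>f. fun_on f A \<and> (\<forall>p x. op p x \<in> El f \<longrightarrow> x \<in> El p)"
    using f_mem by blast
qed

section \<open>From choice functions to homomorphisms\<close>

text \<open>Stands in for a walk from \<open>x\<close> to \<open>y\<close>, with \<open>True\<close>
  for even and \<open>False\<close> for odd length, in a form that a formula over finite sets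
  expresses directly.\<close>

definition forced :: "'a \<Rightarrow> 'a \<Rightarrow> bool \<Rightarrow> 'a \<Rightarrow> 'a \<Rightarrow> bool" where
  "forced V G b x y \<longleftrightarrow> (\<exists>W. fin W \<and> El W \<subseteq> El V \<and> x \<in> El W \<and> y \<in> El W \<and>
     (\<forall>C. colouring G W C \<longrightarrow> ((x \<in> El C \<longleftrightarrow> y \<in> El C) \<longleftrightarrow> b)))"

text \<open>A colouring of the union of two finite witnesses is a colouring of each.\<close>

lemma forced_join:
  assumes "forced V G b x y" "forced V G b' y' z"
  obtains W where "fin W" "El W \<subseteq> El V" "x \<in> El W" "z \<in> El W"
    "\<And>C. colouring G W C \<Longrightarrow> (x \<in> El C \<longleftrightarrow> y \<in> El C) \<longleftrightarrow> b"
    "\<And>C. colouring G W C \<Longrightarrow> (y' \<in> El C \<longleftrightarrow> z \<in> El C) \<longleftrightarrow> b'"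
proof -
  obtain W W' where W: "fin W" "El W \<subseteq> El V" "x \<in> El W"
      "\<forall>C. colouring G W C \<longrightarrow> ((x \<in> El C \<longleftrightarrow> y \<in> El C) \<longleftrightarrow> b)"
    and W': "fin W'" "El W' \<subseteq> El V" "z \<in> El W'"
      "\<forall>C. colouring G W' C \<longrightarrow> ((y' \<in> El C \<longleftrightarrow> z \<in> El C) \<longleftrightarrow> b')"
    using assms unfolding forced_def by blast
  let ?U = "mk (El W \<union> El W')"
  have "colouring G W C" "colouring G W' C" if "colouring G ?U C" for C
    by (rule colouring_mono[OF that]; simp)+
  then show thesis using W W' fin_Un[OF W(1) W'(1)] by (intro that[of ?U]) auto
qed

text \<open>Parities compose: \<open>b = b'\<close> is true exactly when both steps preserve or both
  reverse the colour.\<close>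

lemma forced_trans: "forced V G b x y \<Longrightarrow> forced V G b' y z \<Longrightarrow> forced V G (b = b') x z"
  by (erule (1) forced_join) (unfold forced_def, blast)

lemma forced_sym: "forced V G b x y \<Longrightarrow> forced V G b y x"
  unfolding forced_def by blast

definition fibre :: "'a \<Rightarrow> 'a \<Rightarrow> 'a \<Rightarrow> 'a" where
  "fibre V R y = mk {x \<in> El V. op x y \<in> El R}"

lemma El_fibre [simp]: "El (fibre V R y) = {x \<in> El V. op x y \<in> El R}"
proof -
  have "definable (\<lambda>x. op x y \<in> El R)"
    by (rule definableI[of _ v "[y, R]" "opair_in 2 0 1"]) simp
  then show ?thesis unfolding fibre_def by (intro El_mk small_separation)
qed

definition is_fibre :: "lvl \<Rightarrow> lvl \<Rightarrow> lvl \<Rightarrow> lvl \<Rightarrow> pfm" where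
  "is_fibre s V R y = (\<^bold>\<forall>x. x \<^bold>\<in> s \<^bold>\<longleftrightarrow> x \<^bold>\<in> V \<^bold>\<and> opair_in x y R)"

lemma hold_is_fibre [simp]:
  assumes "s < length vs" "V < length vs" "R < length vs" "y < length vs"
  shows "holds E (=) w vs (is_fibre s V R y) \<longleftrightarrow> vs ! s = fibre (vs ! V) (vs ! R) (vs ! y)"
proof -
  have "holds E (=) w vs (is_fibre s V R y) \<longleftrightarrow> El (vs ! s) = El (fibre (vs ! V) (vs ! R) (vs ! y))"
    using assms by (simp add: is_fibre_def nth_append set_eq_iff del: El_inject)
  then show ?thesis unfolding El_inject .
qed

text \<open>Turns forcing into a set of the model, so that later formulas can take it as a
  parameter.\<close>

lemma ex_forced_relation: "\<exists>R. \<forall>x\<in>El V. \<forall>y\<in>El V. op x y \<in> El R \<longleftrightarrow> forced V G b x y"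
proof -
  obtain X where X: "\<forall>x\<in>El V. \<forall>y\<in>El V. op x y \<in> El X" using small_products by blast
  have "definable (\<lambda>z. \<exists>x y. z = op x y \<and> forced V G b x y)"
    unfolding forced_def
    by (rule definableI[of _ v "[V, G]" "\<^bold>\<exists>x. \<^bold>\<exists>y. is_opair 2 x y \<^bold>\<and>
        (\<^bold>\<exists>W. is_finite W \<^bold>\<and> is_subset W 0 \<^bold>\<and> x \<^bold>\<in> W \<^bold>\<and> y \<^bold>\<in> W \<^bold>\<and>
          (\<^bold>\<forall>C. is_colouring 1 W C \<^bold>\<longrightarrow>
            (if b then x \<^bold>\<in> C \<^bold>\<longleftrightarrow> y \<^bold>\<in> C else \<^bold>\<not> (x \<^bold>\<in> C \<^bold>\<longleftrightarrow> y \<^bold>\<in> C))))"])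
      (cases b; simp add: subset_iff)
  from small_separation[OF this, of X] obtain R
    where R: "El R = {z \<in> El X. \<exists>x y. z = op x y \<and> forced V G b x y}" using El_mk by blast
  have "op x y \<in> El R \<longleftrightarrow> forced V G b x y" if "x \<in> El V" "y \<in> El V" for x y
    unfolding R using X that by simp
  then show ?thesis by blast
qed

lemma AC2_imp_ex_colouring:
  assumes "hold [] AC2"
    and fin: "\<And>W. fin W \<Longrightarrow> El W \<subseteq> El V \<Longrightarrow> \<exists>C. colouring G W C"
  shows "\<exists>C. colouring G V C"
proof -
  obtain S where S: "\<forall>x\<in>El V. \<forall>y\<in>El V. op x y \<in> El S \<longleftrightarrow> forced V G True x y"
    using ex_forced_relation by blast
  obtain D where D: "\<forall>x\<in>El V. \<forall>y\<in>El V. op x y \<in> El D \<longleftrightarrow> forced V G False x y"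
    using ex_forced_relation by blast
  have disjoint: "\<not> (forced V G True x y \<and> forced V G False x y)" for x y
  proof
    assume "forced V G True x y \<and> forced V G False x y"
    \<comment> \<open>Contradictory parities would force \<open>x\<close> to differ in colour from
      itself, leaving some finite \<open>W\<close> without a colouring.\<close>
    then have "forced V G (True = False) x x" by (blast intro: forced_trans forced_sym)
    then obtain W where "fin W" "El W \<subseteq> El V" "\<And>C. \<not> colouring G W C"
      unfolding forced_def by auto
    then show False using fin by blast
  qed
  have refl: "forced V G True x x" if "x \<in> El V" for x
    unfolding forced_def by (intro exI[of _ "up x x"]) (simp add: fin_up that)
  let ?p = "\<lambda>x. up (fibre V S x) (fibre V D x)"
  obtain P where P: "El P = {s. El s \<subseteq> El V}" using El_mk[OF small_Pow] by blast
  obtain PP where PP: "El PP = {s. El s \<subseteq> El P}" using El_mk[OF small_Pow] by blast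
  let ?A = "\<lambda>p. \<exists>x s d. x \<in> El V \<and> s = fibre V S x \<and> d = fibre V D x \<and> p = up s d"
  have "definable ?A"
    by (rule definableI[of _ v "[V, S, D]" "\<^bold>\<exists>x. \<^bold>\<exists>s. \<^bold>\<exists>d. x \<^bold>\<in> 0 \<^bold>\<and>
      is_fibre s 0 1 x \<^bold>\<and> is_fibre d 0 2 x \<^bold>\<and> is_upair 3 s d"]) simp
  from small_separation[OF this, of PP] obtain A where "El A = {p \<in> El PP. ?A p}"
    using El_mk by blast
  then have A: "El A = ?p ` El V" unfolding PP P by auto
  have own: "x \<in> El (fibre V S x)" "x \<notin> El (fibre V D x)" if "x \<in> El V" for x
    using that S D refl disjoint[of x x] by auto
  \<comment> \<open>The vertex \<open>x\<close> lies in the first set but not in the second, so the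
    two are distinct even if the second is empty.\<close>
  have "\<exists>x y. x \<noteq> y \<and> p = up x y" if p: "p \<in> El A" for p
  proof -
    obtain x where "x \<in> El V" "p = ?p x" using p A by blast
    then show ?thesis using own[of x] by metis
  qed
  then obtain f where f: "fun_on f A" "\<And>p x. op p x \<in> El f \<Longrightarrow> x \<in> El p"
    using assms(1) unfolding hold_AC2 by meson
  \<comment> \<open>The colour class consists of the vertices lying in the set chosen from their own
    pair.\<close>
  have "definable (\<lambda>x. \<exists>p s d z. s = fibre V S x \<and> d = fibre V D x \<and> p = up s d \<and> op p z \<in> El f \<and> x \<in> El z)"
    by (rule definableI[of _ v "[V, S, D, f]" "\<^bold>\<exists>p. \<^bold>\<exists>s. \<^bold>\<exists>d. \<^bold>\<exists>z.
      is_fibre s 0 1 4 \<^bold>\<and> is_fibre d 0 2 4 \<^bold>\<and> is_upair p s d \<^bold>\<and> opair_in p z 3 \<^bold>\<and> 4 \<^bold>\<in> z"]) simp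
  from small_separation[OF this, of V] obtain C
    where "El C = {x \<in> El V. \<exists>p s d z. s = fibre V S x \<and> d = fibre V D x \<and> p = up s d \<and> op p z \<in> El f \<and> x \<in> El z}"
    using El_mk by blast
  then have C: "El C = {x \<in> El V. \<exists>z. op (?p x) z \<in> El f \<and> x \<in> El z}" by simp
  have "x \<in> El C \<longleftrightarrow> y \<notin> El C" if xy: "x \<in> El V" "y \<in> El V" "up x y \<in> El G" for x y
  proof -
    have diff: "forced V G False x y"
      unfolding forced_def by (intro exI[of _ "up x y"]) (auto simp: fin_up colouring_def xy)
    \<comment> \<open>Following the edge reverses parity, so \<open>x\<close> and \<open>y\<close>
      have the same two fibres with their roles exchanged.\<close>
    have "forced V G True u x \<longleftrightarrow> forced V G False u y" "forced V G False u x \<longleftrightarrow> forced V G True u y" for u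
      using forced_trans[OF _ diff, of True u] forced_trans[OF _ diff, of False u]
        forced_trans[OF _ forced_sym[OF diff], of True u] forced_trans[OF _ forced_sym[OF diff], of False u]
      by auto
    then have "El (fibre V S x) = El (fibre V D y)" "El (fibre V D x) = El (fibre V S y)"
      using S D xy by (auto simp del: El_inject)
    then have swap: "fibre V S y = fibre V D x" "fibre V D y = fibre V S x"
      unfolding El_inject by simp_all
    then have p: "?p y = ?p x" by (simp add: up_commute)
    obtain z where z: "op (?p x) z \<in> El f" using fun_on_ex[OF f(1)] A xy by blast
    have "x \<in> El C \<longleftrightarrow> x \<in> El z" if "x \<in> El V" "op (?p x) z \<in> El f" for x
      unfolding C using that fun_on_unique[OF f(1) that(2)] by blast
    then have mem: "x \<in> El C \<longleftrightarrow> x \<in> El z" "y \<in> El C \<longleftrightarrow> y \<in> El z"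
      using xy(1,2) z z[folded p] by blast+
    \<comment> \<open>Whichever fibre is chosen, it contains exactly one of \<open>x\<close> and
      \<open>y\<close>.\<close>
    have "z = fibre V S x \<or> z = fibre V D x" using f(2)[OF z] by simp
    then show ?thesis
      unfolding mem using own[OF xy(1)] own[OF xy(2)] unfolding swap by blast
  qed
  then show ?thesis unfolding colouring_def by blast
qed

lemma AC2_imp_P_G_H2:
  assumes "hold [] AC2"
  shows "hold [] P_G_H2"
  unfolding hold_P_G_H2
proof (intro allI impI)
  fix V G V' G'
  assume *: "graph V G \<and> \<not> fin V \<and> loop_graph V' G' \<and> fin V' \<and> (\<exists>a b. a \<noteq> b \<and> V' = up a b) \<and>
    (\<forall>W F. graph W F \<and> El W \<subseteq> El V \<and> El F \<subseteq> El G \<and> fin W \<longrightarrow> (\<exists>f. hom f W F V' G'))"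
  then obtain a b where V': "V' = up a b" by blast
  have graph: "graph V G" using * by blast
  have sub: "\<exists>f. hom f W F V' G'" if "graph W F" "El W \<subseteq> El V" "El F \<subseteq> El G" "fin W" for W F
    using * that by blast
  show "\<exists>f. hom f V G V' G'"
  proof (cases "up a a \<in> El G' \<or> up b b \<in> El G' \<or> El G = {}")
    case True
    then obtain c where "c \<in> El V'" "up c c \<in> El G' \<or> El G = {}" using V' by auto
    then show ?thesis by (rule const_hom) blast
  next
    case False
    have col: "\<exists>C. colouring G W C" if W: "fin W" "El W \<subseteq> El V" for W
    proof -
      obtain F where F: "graph W F" "El F \<subseteq> El G"
        "\<And>x y. x \<in> El W \<Longrightarrow> y \<in> El W \<Longrightarrow> up x y \<in> El F \<longleftrightarrow> up x y \<in> El G"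
        using ex_induced_subgraph[OF graph W(2)] by blast
      obtain f where "hom f W F (up a b) G'" using sub[OF F(1) W(2) F(2) W(1)] V' by blast
      then obtain C where "colouring F W C" by (rule hom_imp_colouring) (use False in auto)
      then have "colouring G W C" using F(3) unfolding colouring_def by blast
      then show ?thesis by blast
    qed
    obtain C where C: "colouring G V C"
      using AC2_imp_ex_colouring[OF assms] col by blast
    \<comment> \<open>An edge of the target is still required; the image of an edge of
      \<open>G\<close> under a homomorphism from its two-vertex subgraph provides one.\<close>
    obtain e where e: "e \<in> El G" using False by blast
    then obtain x y where xy: "x \<in> El V" "y \<in> El V" "e = up x y"
      using graph unfolding graph_def loop_graph_def by meson
    have W: "El (up x y) \<subseteq> El V" using xy by simp
    obtain F where F: "graph (up x y) F" "El F \<subseteq> El G" "up x y \<in> El F"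
      using ex_induced_subgraph[OF graph W] xy(3) e El_up by (metis insertCI)
    obtain f where f: "hom f (up x y) F V' G'" using sub[OF F(1) W F(2) fin_up] by blast
    then have "fun_on f (up x y)" unfolding hom_def by blast
    from fun_on_ex[OF this] obtain x' y' where xy': "op x x' \<in> El f" "op y y' \<in> El f"
      by fastforce
    have "x' \<in> El V'" "y' \<in> El V'" "up x' y' \<in> El G'"
      using f xy' F(3) unfolding hom_def by blast+
    with C show ?thesis by (rule colouring_imp_hom) blast
  qed
qed

end

theorem proposition3p6: "ZF \<turnstile> (P_G_H2 \<^bold>\<longleftrightarrow> AC2) 0"
proof (rule ZF_derivable)
  fix E and v :: "nat \<Rightarrow> nat"
  assume "\<forall>q\<in>ZF. sat E (=) v q"
  then interpret zf_model E v by unfold_locales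
  have "hold [] P_G_H2 \<longleftrightarrow> hold [] AC2"
    using AC2_imp_P_G_H2 P_G_H2_imp_AC2 by blast
  then show "sat E (=) v ((P_G_H2 \<^bold>\<longleftrightarrow> AC2) 0)"
    by (simp only: sat_closed holds_iff)
qed

end
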